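(* Let $(M,F)$ be the Minkowskian product Finsler manifold of the Finsler manifolds $(M_1,F_1)$ and $(M_2,F_2)$ with respect to a product function $f$. Then the Cartan nonlinear connection coefficients $\Gamma^\alpha_\beta$ associated to $F$ are given by $$(\Gamma^\alpha_\beta)=\begin{pmatrix}\Gamma^i_j&\Gamma^{i'}_j\\ \Gamma^i_{j'}&\Gamma^{i'}_{j'}\end{pmatrix},\qquad \Gamma^i_j=\overset{1}{\Gamma}{}^i_j,\quad \Gamma^{i'}_{j'}=\overset{2}{\Gamma}{}^{i'}_{j'},\quad \Gamma^{i'}_j=\Gamma^i_{j'}=0,$$ where $\overset{1}{\Gamma}{}^i_j$ and $\overset{2}{\Gamma}{}^{i'}_{j'}$ are the Cartan nonlinear connection coefficients associated to $F_1$ and $F_2$ respectively.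
   Context: A Finsler metric on a manifold $N$ is a function $F:TN\to[0,\infty)$ such that: $G=F^2$ is smooth on $TN\setminus\{0\}$; $F>0$ off the zero section; $F(x,\lambda y)=|\lambda|F(x,y)$ for all $\lambda\in\mathbb{R}$; and the Hessian $(G_{\alpha\beta})=\left(\frac{\partial^2G}{\partial y^\alpha\partial y^\beta}\right)$ (no factor $\frac12$) is positive definite off the zero section. $(G^{\alpha\beta})$ denotes the inverse matrix of $(G_{\alpha\beta})$. A product function is a continuous $f:[0,\infty)\times[0,\infty)\to[0,\infty)$ with: (a) $f(s,t)=0$ iff $(s,t)=(0,0)$; (b) $f(\lambda s,\lambda t)=\lambda f(s,t)$ for $\lambda\ge 0$; (c) $f$ is smooth on $(0,\infty)^2$; (d) $\frac{\partial f}{\partial s}\ne0$ and $\frac{\partial f}{\partial t}\neq0$ on $(0,\infty)^2$; (e) $\frac{\partial f}{\partial s}\frac{\partial f}{\partial t}-2f\frac{\partial^2f}{\partial s\partial t}\ne0$ on $(0,\infty)^2$. Given Finsler manifolds $(M_1,F_1)$, $(M_2,F_2)$ of dimensions $m$, $n$, put $K=F_1^2$, $H=F_2^2$. The Minkowskian product Finsler manifold with respect to $f$ is $M=M_1\times M_2$ with $F=\sqrt{f(K,H)}$ on $TM\cong TM_1\oplus TM_2$; write $G=F^2=f(K,H)$. Since $f$ is smooth only on the open quadrant, all geometric objects of $F$ are considered at points $(x,y)\in TM$ whose $TM_1$- and $TM_2$-components are both nonzero (i.e. $K\ne0$, $H\ne0$); $(G_{\alpha\beta})$ is invertible there. Local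 coordinates: $x=(x^i,x^{i'})$ with $(x^i)$ on $M_1$ and $(x^{i'})$ on $M_2$, with induced fiber coordinates $y=(y^i,y^{i'})$; Greek indices run over $1,\dots,m+n$, unprimed Latin indices over $1,\dots,m$, primed Latin indices over $m+1,\dots,m+n$. The summation convention is used. For a Finsler metric (or for the product $F$) with $G=F^2$, set $\mathbb{G}^\alpha=\frac12G^{\alpha\beta}\left(\frac{\partial^2G}{\partial y^\beta\partial x^\gamma}y^\gamma-\frac{\partial G}{\partial x^\beta}\right)$; the Cartan nonlinear connection coefficients are $\Gamma^\alpha_\beta=\frac{\partial\mathbb{G}^\alpha}{\partial y^\beta}$. Superscripts $1$, $2$ over a symbol denote the same object computed for $(M_1,F_1)$ (evaluated at $(x^i,y^i)$) and $(M_2,F_2)$ (evaluated at $(x^{i'},y^{i'})$). *)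

theory Defs
  imports "HOL-Analysis.Analysis"
begin

text \<open>\<open>Ck_on k f S\<close>, for open \<open>S\<close>: f is k times continuously differentiable on S, expressed through
  iterated directional derivatives (the domain is finite-dimensional in all uses below).\<close>

primrec Ck_on :: "nat \<Rightarrow> ('a::real_normed_vector \<Rightarrow> 'b::real_normed_vector) \<Rightarrow> 'a set \<Rightarrow> bool" where
  "Ck_on 0 f S \<longleftrightarrow> continuous_on S f"
| "Ck_on (Suc k) f S \<longleftrightarrow> (\<forall>x\<in>S. f differentiable (at x)) \<and>
     (\<forall>v. Ck_on k (\<lambda>x. frechet_derivative f (at x) v) S)"

definition smooth_on :: "'a set \<Rightarrow> ('a::real_normed_vector \<Rightarrow> 'b::real_normed_vector) \<Rightarrow> bool" where
  "smooth_on S f \<longleftrightarrow> open S \<and> (\<forall>k. Ck_on k f S)"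

text \<open>A chart consists of its domain and its coordinate map; the values of the coordinate map
  outside the domain are irrelevant.\<close>

type_synonym ('a, 'm) chart = "'a set \<times> ('a \<Rightarrow> real^'m)"

definition chart_inv :: "('a, 'm::finite) chart \<Rightarrow> real^'m \<Rightarrow> 'a" where
  "chart_inv c = inv_into (fst c) (snd c)"

definition is_chart :: "'a topology \<Rightarrow> ('a, 'm::finite) chart \<Rightarrow> bool" where
  "is_chart X c \<longleftrightarrow> openin X (fst c) \<and> open (snd c ` fst c) \<and>
     homeomorphic_map (subtopology X (fst c)) (top_of_set (snd c ` fst c)) (snd c)"

text \<open>The atlas is arbitrary; it may be, but need not be, maximal.\<close>

definition smooth_manifold :: "'a topology \<Rightarrow> ('a, 'm::finite) chart set \<Rightarrow> bool" where
  "smooth_manifold X A \<longleftrightarrow> Hausdorff_space X \<and> second_countable X \<and>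
     (\<forall>c\<in>A. is_chart X c) \<and> (\<Union>c\<in>A. fst c) = topspace X \<and>
     (\<forall>c\<in>A. \<forall>d\<in>A. smooth_on (snd c ` (fst c \<inter> fst d)) (snd d \<circ> chart_inv c))"

definition charts_at :: "('a, 'm::finite) chart set \<Rightarrow> 'a \<Rightarrow> ('a, 'm) chart set" where
  "charts_at A p = {c \<in> A. p \<in> fst c}"

text \<open>A tangent vector at p is given by its component vectors with respect to all charts around p,
  which transform by the differentials of the coordinate changes. The values at charts not
  containing p are set to 0, so that tangent vectors are determined by their components.\<close>

type_synonym ('a, 'm) tangent_vec = "('a, 'm) chart \<Rightarrow> real^'m"

definition tangent_space :: "('a, 'm::finite) chart set \<Rightarrow> 'a \<Rightarrow> ('a, 'm) tangent_vec set" where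
  "tangent_space A p = {v.
     (\<forall>c\<in>charts_at A p. \<forall>d\<in>charts_at A p.
        v d = frechet_derivative (snd d \<circ> chart_inv c) (at (snd c p)) (v c)) \<and>
     (\<forall>c. c \<notin> charts_at A p \<longrightarrow> v c = 0)}"

text \<open>The tangent vector at p whose components in the chart c are y.\<close>

definition tangent_of_components ::
    "('a, 'm::finite) chart set \<Rightarrow> ('a, 'm) chart \<Rightarrow> 'a \<Rightarrow> real^'m \<Rightarrow> ('a, 'm) tangent_vec" where
  "tangent_of_components A c p y = (\<lambda>d. if d \<in> charts_at A p
     then frechet_derivative (snd d \<circ> chart_inv c) (at (snd c p)) y else 0)"

text \<open>The differential at p of a smooth map g between manifolds with atlases A and B. It does not
  depend on the choice of the chart around p.\<close>

definition tangent_map ::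
    "('a, 'm::finite) chart set \<Rightarrow> ('b, 'n::finite) chart set \<Rightarrow> ('a \<Rightarrow> 'b) \<Rightarrow> 'a \<Rightarrow>
     ('a, 'm) tangent_vec \<Rightarrow> ('b, 'n) tangent_vec" where
  "tangent_map A B g p v = (\<lambda>d. if d \<in> charts_at B (g p)
     then (let c = (SOME c. c \<in> charts_at A p)
           in frechet_derivative (snd d \<circ> g \<circ> chart_inv c) (at (snd c p)) (v c))
     else 0)"

text \<open>A function G on the tangent bundle is written in induced coordinates as a function \<open>G x y\<close> of
  base coordinates x and fiber coordinates y; \<open>dx\<close> and \<open>dy\<close> are the partial derivatives with
  respect to single base and fiber coordinates.\<close>

definition dx :: "'k::finite \<Rightarrow> (real^'k \<Rightarrow> real^'k \<Rightarrow> real) \<Rightarrow> real^'k \<Rightarrow> real^'k \<Rightarrow> real" where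
  "dx \<alpha> G x y = deriv (\<lambda>t. G (x + t *\<^sub>R axis \<alpha> 1) y) 0"

definition dy :: "'k::finite \<Rightarrow> (real^'k \<Rightarrow> real^'k \<Rightarrow> real) \<Rightarrow> real^'k \<Rightarrow> real^'k \<Rightarrow> real" where
  "dy \<alpha> G x y = deriv (\<lambda>t. G x (y + t *\<^sub>R axis \<alpha> 1)) 0"

definition fiber_hessian :: "(real^'k::finite \<Rightarrow> real^'k \<Rightarrow> real) \<Rightarrow> real^'k \<Rightarrow> real^'k \<Rightarrow> real^'k^'k" where
  "fiber_hessian G x y = (\<chi> \<alpha> \<beta>. dy \<alpha> (dy \<beta> G) x y)"

definition spray_coeff :: "(real^'k::finite \<Rightarrow> real^'k \<Rightarrow> real) \<Rightarrow> 'k \<Rightarrow> real^'k \<Rightarrow> real^'k \<Rightarrow> real" where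
  "spray_coeff G \<alpha> x y = 1/2 * (\<Sum>\<beta>\<in>UNIV. matrix_inv (fiber_hessian G x y) $ \<alpha> $ \<beta> *
     ((\<Sum>\<gamma>\<in>UNIV. dy \<beta> (dx \<gamma> G) x y * y $ \<gamma>) - dx \<beta> G x y))"

text \<open>\<open>cartan_coeff G \<alpha> \<beta>\<close> is the coefficient with upper index \<open>\<alpha>\<close> and lower index \<open>\<beta>\<close>.\<close>

definition cartan_coeff :: "(real^'k::finite \<Rightarrow> real^'k \<Rightarrow> real) \<Rightarrow> 'k \<Rightarrow> 'k \<Rightarrow> real^'k \<Rightarrow> real^'k \<Rightarrow> real" where
  "cartan_coeff G \<alpha> \<beta> x y = dy \<beta> (spray_coeff G \<alpha>) x y"

text \<open>The coordinate expression of \<open>F\<^sup>2\<close> in the chart c.\<close>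

definition energy_in_chart ::
    "('a, 'm::finite) chart set \<Rightarrow> ('a \<Rightarrow> ('a, 'm) tangent_vec \<Rightarrow> real) \<Rightarrow> ('a, 'm) chart \<Rightarrow>
     real^'m \<Rightarrow> real^'m \<Rightarrow> real" where
  "energy_in_chart A F c x y =
     (F (chart_inv c x) (tangent_of_components A c (chart_inv c x) y))\<^sup>2"

definition finsler_metric ::
    "('a, 'm::finite) chart set \<Rightarrow> ('a \<Rightarrow> ('a, 'm) tangent_vec \<Rightarrow> real) \<Rightarrow> bool" where
  "finsler_metric A F \<longleftrightarrow>
     (\<forall>p \<in> (\<Union>c\<in>A. fst c). \<forall>v \<in> tangent_space A p.
        F p v \<ge> 0 \<and> (v \<noteq> (\<lambda>_. 0) \<longrightarrow> F p v > 0) \<and>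
        (\<forall>l::real. F p (\<lambda>c. l *\<^sub>R v c) = \<bar>l\<bar> * F p v)) \<and>
     (\<forall>c\<in>A. smooth_on ((snd c ` fst c) \<times> (- {0})) (\<lambda>(x, y). energy_in_chart A F c x y)) \<and>
     (\<forall>c\<in>A. \<forall>x \<in> snd c ` fst c. \<forall>y. y \<noteq> 0 \<longrightarrow>
        (\<forall>\<xi>. \<xi> \<noteq> 0 \<longrightarrow> \<xi> \<bullet> (fiber_hessian (energy_in_chart A F c) x y *v \<xi>) > 0))"

definition finsler_manifold ::
    "'a topology \<Rightarrow> ('a, 'm::finite) chart set \<Rightarrow> ('a \<Rightarrow> ('a, 'm) tangent_vec \<Rightarrow> real) \<Rightarrow> bool" where
  "finsler_manifold X A F \<longleftrightarrow> smooth_manifold X A \<and> finsler_metric A F"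

definition product_function :: "(real \<Rightarrow> real \<Rightarrow> real) \<Rightarrow> bool" where
  "product_function f \<longleftrightarrow>
     (\<forall>s\<ge>0. \<forall>t\<ge>0. f s t \<ge> 0) \<and>
     continuous_on ({0..} \<times> {0..}) (\<lambda>(s, t). f s t) \<and>
     (\<forall>s\<ge>0. \<forall>t\<ge>0. f s t = 0 \<longleftrightarrow> s = 0 \<and> t = 0) \<and>
     (\<forall>l\<ge>0. \<forall>s\<ge>0. \<forall>t\<ge>0. f (l * s) (l * t) = l * f s t) \<and>
     smooth_on ({0<..} \<times> {0<..}) (\<lambda>(s, t). f s t) \<and>
     (\<forall>s>0. \<forall>t>0. deriv (\<lambda>s. f s t) s \<noteq> 0 \<and> deriv (\<lambda>t. f s t) t \<noteq> 0 \<and>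
        deriv (\<lambda>s. f s t) s * deriv (\<lambda>t. f s t) t
          - 2 * f s t * deriv (\<lambda>s. deriv (\<lambda>t. f s t) t) s \<noteq> 0)"

text \<open>Coordinates on a product are indexed by the disjoint sum of the index types: \<open>Inl i\<close> is an
  unprimed and \<open>Inr i'\<close> a primed index.\<close>

definition join_coords :: "real^'m \<Rightarrow> real^'n \<Rightarrow> real^('m::finite + 'n::finite)" where
  "join_coords x x' = (\<chi> \<alpha>. case \<alpha> of Inl i \<Rightarrow> x $ i | Inr i' \<Rightarrow> x' $ i')"

definition left_coords :: "real^('m::finite + 'n::finite) \<Rightarrow> real^'m" where
  "left_coords x = (\<chi> i. x $ Inl i)"

definition right_coords :: "real^('m::finite + 'n::finite) \<Rightarrow> real^'n" where
  "right_coords x = (\<chi> i'. x $ Inr i')"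

definition product_chart ::
    "('a, 'm::finite) chart \<Rightarrow> ('b, 'n::finite) chart \<Rightarrow> ('a \<times> 'b, 'm + 'n) chart" where
  "product_chart c d = (fst c \<times> fst d, \<lambda>(p, q). join_coords (snd c p) (snd d q))"

definition product_atlas ::
    "('a, 'm::finite) chart set \<Rightarrow> ('b, 'n::finite) chart set \<Rightarrow> ('a \<times> 'b, 'm + 'n) chart set" where
  "product_atlas A B = {product_chart c d | c d. c \<in> A \<and> d \<in> B}"

text \<open>The two components of a tangent vector of the product manifold under the isomorphism
  \<open>T(M\<^sub>1 \<times> M\<^sub>2) \<cong> TM\<^sub>1 \<oplus> TM\<^sub>2\<close>, namely its images under the differentials of the projections.\<close>

definition tangent_fst ::
    "('a, 'm::finite) chart set \<Rightarrow> ('b, 'n::finite) chart set \<Rightarrow> 'a \<times> 'b \<Rightarrow>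
     ('a \<times> 'b, 'm + 'n) tangent_vec \<Rightarrow> ('a, 'm) tangent_vec" where
  "tangent_fst A B = tangent_map (product_atlas A B) A fst"

definition tangent_snd ::
    "('a, 'm::finite) chart set \<Rightarrow> ('b, 'n::finite) chart set \<Rightarrow> 'a \<times> 'b \<Rightarrow>
     ('a \<times> 'b, 'm + 'n) tangent_vec \<Rightarrow> ('b, 'n) tangent_vec" where
  "tangent_snd A B = tangent_map (product_atlas A B) B snd"

definition minkowskian_product ::
    "(real \<Rightarrow> real \<Rightarrow> real) \<Rightarrow>
     ('a, 'm::finite) chart set \<Rightarrow> ('a \<Rightarrow> ('a, 'm) tangent_vec \<Rightarrow> real) \<Rightarrow>
     ('b, 'n::finite) chart set \<Rightarrow> ('b \<Rightarrow> ('b, 'n) tangent_vec \<Rightarrow> real) \<Rightarrow>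
     'a \<times> 'b \<Rightarrow> ('a \<times> 'b, 'm + 'n) tangent_vec \<Rightarrow> real" where
  "minkowskian_product f A F1 B F2 p w =
     sqrt (f ((F1 (fst p) (tangent_fst A B p w))\<^sup>2) ((F2 (snd p) (tangent_snd A B p w))\<^sup>2))"

end

theory Submission
  imports Defs
begin

text \<open>Write \<open>K\<close>, \<open>H\<close> and \<open>G = f (K, H)\<close> for the three energies in induced coordinates, with
  lower indices for fiber derivatives and a semicolon before base derivatives, and let
  \<open>S\<close> denote the spray coefficients. The Cartan coefficients are fiber derivatives of \<open>S\<close>, so it
  suffices that the spray of \<open>G\<close> consists, on an open set of fiber coordinates, of the spray of \<open>K\<close>
  and the spray of \<open>H\<close>: then the diagonal blocks are those of the factors, and the mixed blocks are
  derivatives of functions that do not depend on the variable in question.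

  The spray solves the linear system whose matrix is the fiber Hessian and whose right hand side is
  the Euler-Lagrange expression \<open>E_\<alpha> = G_{\<alpha>;\<gamma>} y^\<gamma> - G_{;\<alpha>}\<close>. By the chain rule both sides
  of the system for \<open>G\<close> are combinations of those for \<open>K\<close> and \<open>H\<close>, with the same coefficients,
  provided that \<open>K_j 2 S^j = K_{;k} y^k\<close> and likewise for \<open>H\<close>. This identity says that the energy is
  constant along geodesics and follows from Euler's relations (\<open>energy_preserved_by_spray\<close>). Hence the
  pair of sprays solves the system for \<open>G\<close> (\<open>spray_of_product\<close>).

  For it to be the only solution, the Hessian of \<open>G\<close> has to be nondegenerate
  (\<open>energy_hessian_kernel\<close>). It need not be definite. Contracting the kernel equation with the two
  halves of \<open>y\<close> leaves a \<open>2 \<times> 2\<close> system with determinant \<open>f_s f_t - 2 f f_{st}\<close>, which does not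
  vanish for a product function.

  What remains is to see that the coordinate expression of the product metric is \<open>f (K, H)\<close>
  (\<open>minkowskian_product_energy_in_chart\<close>): in product charts the differentials of the projections
  are the coordinate projections, by the chain rule for the transition maps
  (\<open>tangent_projections\<close>).\<close>

section \<open>Derivatives along coordinate directions\<close>

lemma differentiable_imp_DERIV_line:
  fixes g :: "'v::real_normed_vector \<Rightarrow> real"
  assumes "g differentiable (at x)"
  shows "((\<lambda>t. g (x + t *\<^sub>R v)) has_field_derivative frechet_derivative g (at x) v) (at 0)"
proof -
  have g: "(g has_derivative frechet_derivative g (at x)) (at (x + 0 *\<^sub>R v))"
    using assms by (simp add: frechet_derivative_works)
  have "((\<lambda>t. x + t *\<^sub>R v) has_derivative (\<lambda>t. t *\<^sub>R v)) (at 0)"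
    by (auto intro!: derivative_eq_intros)
  from has_derivative_compose[OF this g]
  have "((\<lambda>t. g (x + t *\<^sub>R v)) has_derivative (\<lambda>t. frechet_derivative g (at x) (t *\<^sub>R v))) (at 0)" .
  moreover have "frechet_derivative g (at x) (t *\<^sub>R v) = frechet_derivative g (at x) v * t" for t
    using linear_cmul[OF linear_frechet_derivative[OF assms]] by simp
  ultimately show ?thesis
    by (simp add: has_field_derivative_def mult.commute[of _ "frechet_derivative g (at x) v"])
qed

lemma deriv_line_eq_frechet_derivative:
  fixes g :: "'v::real_normed_vector \<Rightarrow> real"
  assumes "g differentiable (at x)"
  shows "deriv (\<lambda>t. g (x + t *\<^sub>R v)) 0 = frechet_derivative g (at x) v"
  using differentiable_imp_DERIV_line[OF assms] by (rule DERIV_imp_deriv)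

lemma smooth_on_imp_differentiable:
  assumes "smooth_on S g" "x \<in> S"
  shows "g differentiable (at x)"
  using assms Ck_on.simps(2)[of 0 g S] unfolding smooth_on_def by blast

text \<open>The iterated coordinate derivatives are defined by one-dimensional limits, while smoothness
  speaks of Frechet derivatives; on the open set \<open>S\<close> the two agree near \<open>x\<close>.\<close>

lemma smooth_on_directional_deriv_differentiable:
  fixes g :: "'v::real_normed_vector \<Rightarrow> real"
  assumes "smooth_on S g" "x \<in> S"
  shows "(\<lambda>z. deriv (\<lambda>t. g (z + t *\<^sub>R v)) 0) differentiable (at x)"
proof -
  have "Ck_on (Suc (Suc 0)) g S" "open S"
    using assms unfolding smooth_on_def by blast+
  then have "(\<lambda>z. frechet_derivative g (at z) v) differentiable (at x)"
    using assms by auto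
  moreover have "frechet_derivative g (at z) v = deriv (\<lambda>t. g (z + t *\<^sub>R v)) 0" if "z \<in> S" for z
    using deriv_line_eq_frechet_derivative smooth_on_imp_differentiable[OF assms(1) that]
    by metis
  ultimately show ?thesis
    using \<open>open S\<close> assms(2) unfolding differentiable_def
    by (meson has_derivative_transform_within_open)
qed

lemma eventually_line_in_open:
  fixes x :: "'v::real_normed_vector"
  assumes "open S" "x \<in> S"
  shows "eventually (\<lambda>t. x + t *\<^sub>R v \<in> S) (nhds 0)"
proof -
  have "((\<lambda>t. x + t *\<^sub>R v) \<longlongrightarrow> x + 0 *\<^sub>R v) (at 0)"
    by (intro tendsto_intros)
  then have "eventually (\<lambda>t. x + t *\<^sub>R v \<in> S) (at 0)"
    using assms topological_tendstoD by fastforce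
  then show ?thesis
    using assms by (auto simp: eventually_nhds_conv_at)
qed

text \<open>Needed to turn a derivative in the direction of the position vector into the index sums of
  tensor notation.\<close>

lemma frechet_derivative_eq_gradient:
  fixes g :: "real^'k::finite \<Rightarrow> real"
  assumes "g differentiable (at x)"
  shows "frechet_derivative g (at x) v = (\<Sum>i\<in>UNIV. v $ i * deriv (\<lambda>t. g (x + t *\<^sub>R axis i 1)) 0)"
proof -
  have lin: "linear (frechet_derivative g (at x))"
    by (rule linear_frechet_derivative[OF assms])
  have "frechet_derivative g (at x) v = frechet_derivative g (at x) (\<Sum>i\<in>UNIV. v $ i *\<^sub>R axis i 1)"
    using basis_expansion[of v] by (simp add: scalar_mult_eq_scaleR)
  also have "\<dots> = (\<Sum>i\<in>UNIV. v $ i * frechet_derivative g (at x) (axis i 1))"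
    by (simp add: linear_sum[OF lin] linear_cmul[OF lin])
  finally show ?thesis
    by (simp add: deriv_line_eq_frechet_derivative[OF assms])
qed

text \<open>Euler's relation, from differentiating \<open>l \<mapsto> g (l *\<^sub>R y)\<close> at \<open>l = 1\<close>.\<close>

lemma Euler_homogeneous:
  fixes g :: "real^'k::finite \<Rightarrow> real"
  assumes diff: "g differentiable (at y)"
    and hom: "\<And>l. l > 0 \<Longrightarrow> g (l *\<^sub>R y) = l ^ d * g y"
  shows "(\<Sum>i\<in>UNIV. y $ i * deriv (\<lambda>t. g (y + t *\<^sub>R axis i 1)) 0) = real d * g y"
proof -
  have "((\<lambda>t. g (y + t *\<^sub>R y)) has_field_derivative frechet_derivative g (at y) y) (at 0)"
    by (rule differentiable_imp_DERIV_line[OF diff])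
  moreover have "((\<lambda>t. g (y + t *\<^sub>R y)) has_field_derivative real d * g y) (at 0)"
  proof (rule DERIV_cong_ev[THEN iffD2, OF refl _ refl])
    show "eventually (\<lambda>t. g (y + t *\<^sub>R y) = (1 + t) ^ d * g y) (nhds 0)"
      using eventually_nhds_in_open[of "{-1<..}" "0::real"]
    proof (rule eventually_mono)
      show "g (y + t *\<^sub>R y) = (1 + t) ^ d * g y" if "t \<in> {-1<..}" for t
        using hom[of "1 + t"] that by (simp add: scaleR_add_left)
    qed auto
    show "((\<lambda>t. (1 + t) ^ d * g y) has_field_derivative real d * g y) (at 0)"
      by (auto intro!: derivative_eq_intros)
  qed
  ultimately show ?thesis
    unfolding frechet_derivative_eq_gradient[OF diff, symmetric] by (rule DERIV_unique)
qed

lemma differentiable_slices: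
  assumes "(\<lambda>(x, y). g x y) differentiable (at (x, y))"
  shows "(\<lambda>x. g x y) differentiable (at x)" and "(\<lambda>y. g x y) differentiable (at y)"
proof -
  from assms obtain D where D: "((\<lambda>(x, y). g x y) has_derivative D) (at (x, y))"
    unfolding differentiable_def by blast
  have "((\<lambda>x. (x, y)) has_derivative (\<lambda>h. (h, 0))) (at x)"
    and "((\<lambda>y. (x, y)) has_derivative (\<lambda>h. (0, h))) (at y)"
    by (auto intro!: derivative_eq_intros)
  from this[THEN has_derivative_compose, OF D]
  show "(\<lambda>x. g x y) differentiable (at x)" and "(\<lambda>y. g x y) differentiable (at y)"
    by (auto simp: differentiable_def)
qed

section \<open>Solving for the spray\<close>

lemma matrix_invertible_if_trivial_kernel:
  fixes M :: "real^'k::finite^'k"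
  assumes "\<And>z. M *v z = 0 \<Longrightarrow> z = 0"
  shows "invertible M"
  using assms by (metis invertible_left_inverse matrix_left_invertible_ker)

lemma matrix_inv_mult:
  fixes M :: "real^'k::finite^'k"
  assumes "invertible M"
  shows "M ** matrix_inv M = mat 1" "matrix_inv M ** M = mat 1"
  using assms unfolding invertible_def matrix_inv_def
  by (metis (mono_tags, lifting) someI_ex)+

abbreviation euler_lagrange ::
    "(real^'k::finite \<Rightarrow> real^'k \<Rightarrow> real) \<Rightarrow> 'k \<Rightarrow> real^'k \<Rightarrow> real^'k \<Rightarrow> real" where
  "euler_lagrange G \<beta> x y \<equiv> (\<Sum>\<gamma>\<in>UNIV. dy \<beta> (dx \<gamma> G) x y * y $ \<gamma>) - dx \<beta> G x y"

text \<open>The inverse matrix in the definition of the spray is only ever handled through the linear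
  system that the spray solves.\<close>

lemma spray_coeff_unique:
  assumes "\<And>z. fiber_hessian G x y *v z = 0 \<Longrightarrow> z = 0"
    and "\<And>\<alpha>. (\<Sum>\<beta>\<in>UNIV. dy \<alpha> (dy \<beta> G) x y * (2 * \<sigma> \<beta>)) = euler_lagrange G \<alpha> x y"
  shows "spray_coeff G \<alpha> x y = \<sigma> \<alpha>"
proof -
  let ?M = "fiber_hessian G x y" and ?s = "\<chi> \<beta>. 2 * \<sigma> \<beta>"
  have E: "(\<chi> \<alpha>. euler_lagrange G \<alpha> x y) = ?M *v ?s"
    using assms(2) by (simp add: vec_eq_iff matrix_vector_mult_def fiber_hessian_def)
  have "matrix_inv ?M *v (?M *v ?s) = ?s"
    using matrix_inv_mult(2)[OF matrix_invertible_if_trivial_kernel[OF assms(1)]]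
    by (simp add: matrix_vector_mul_assoc)
  then have "(matrix_inv ?M *v (\<chi> \<alpha>. euler_lagrange G \<alpha> x y)) $ \<alpha> = 2 * \<sigma> \<alpha>"
    unfolding E by simp
  then show ?thesis
    by (simp add: spray_coeff_def matrix_vector_mult_def)
qed

section \<open>Energy functions in a chart\<close>

text \<open>The coordinate expression of the square of a Finsler metric, on the domain \<open>U\<close> of base
  coordinates of a chart.\<close>

locale finsler_energy =
  fixes U :: "(real^'k::finite) set" and K :: "real^'k \<Rightarrow> real^'k \<Rightarrow> real"
  assumes open_base: "open U"
    and smooth: "smooth_on (U \<times> (- {0})) (\<lambda>(x, y). K x y)"
    and energy_pos: "\<And>x y. x \<in> U \<Longrightarrow> y \<noteq> 0 \<Longrightarrow> K x y > 0"
    and homogeneous: "\<And>x y l. x \<in> U \<Longrightarrow> K x (l *\<^sub>R y) = l\<^sup>2 * K x y"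
    and hessian_pos: "\<And>x y \<xi>. x \<in> U \<Longrightarrow> y \<noteq> 0 \<Longrightarrow> \<xi> \<noteq> 0 \<Longrightarrow>
      \<xi> \<bullet> (fiber_hessian K x y *v \<xi>) > 0"
begin

lemma differentiable_bundle:
  assumes "x \<in> U" "y \<noteq> 0"
  shows "(\<lambda>(x, y). K x y) differentiable (at (x, y))"
    and "(\<lambda>(x, y). dx i K x y) differentiable (at (x, y))"
    and "(\<lambda>(x, y). dy i K x y) differentiable (at (x, y))"
proof -
  have xy: "(x, y) \<in> U \<times> (- {0})"
    using assms by simp
  show "(\<lambda>(x, y). K x y) differentiable (at (x, y))"
    by (rule smooth_on_imp_differentiable[OF smooth xy])
  show "(\<lambda>(x, y). dx i K x y) differentiable (at (x, y))"
    using smooth_on_directional_deriv_differentiable[OF smooth xy, of "(axis i 1, 0)"]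
    by (simp add: dx_def case_prod_beta')
  show "(\<lambda>(x, y). dy i K x y) differentiable (at (x, y))"
    using smooth_on_directional_deriv_differentiable[OF smooth xy, of "(0, axis i 1)"]
    by (simp add: dy_def case_prod_beta')
qed

lemmas differentiable_partials =
  differentiable_bundle[THEN differentiable_slices(2)]
  differentiable_bundle(1)[THEN differentiable_slices(1)]

lemma dx_homogeneous:
  assumes "x \<in> U" "y \<noteq> 0"
  shows "dx i K x (l *\<^sub>R y) = l\<^sup>2 * dx i K x y"
proof -
  have "dx i K x (l *\<^sub>R y) = deriv (\<lambda>t. l\<^sup>2 * K (x + t *\<^sub>R axis i 1) y) 0"
    unfolding dx_def
    by (rule deriv_cong_ev)
      (use eventually_line_in_open[OF open_base assms(1), of "axis i 1"] in
        \<open>auto elim!: eventually_mono simp: homogeneous\<close>)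
  also have "\<dots> = l\<^sup>2 * dx i K x y"
    unfolding dx_def
    by (rule DERIV_imp_deriv, rule DERIV_cmult)
      (use differentiable_imp_DERIV_line[OF differentiable_partials(4)[OF assms]]
        deriv_line_eq_frechet_derivative[OF differentiable_partials(4)[OF assms]] in metis)
  finally show ?thesis .
qed

lemma dy_homogeneous:
  assumes "x \<in> U" "y \<noteq> 0" "l > 0"
  shows "dy i K x (l *\<^sub>R y) = l * dy i K x y"
proof -
  have "K x (l *\<^sub>R y + t *\<^sub>R axis i 1) = l\<^sup>2 * K x (y + t *\<^sub>R (axis i 1 /\<^sub>R l))" for t
    using homogeneous[OF assms(1), of l "y + t *\<^sub>R (axis i 1 /\<^sub>R l)"] assms(3)
    by (simp add: scaleR_add_right mult.left_commute[of l])
  then have "dy i K x (l *\<^sub>R y) = deriv (\<lambda>t. l\<^sup>2 * K x (y + t *\<^sub>R (axis i 1 /\<^sub>R l))) 0"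
    unfolding dy_def by simp
  also have "\<dots> = l\<^sup>2 * frechet_derivative (K x) (at y) (axis i 1 /\<^sub>R l)"
    by (intro DERIV_imp_deriv DERIV_cmult differentiable_imp_DERIV_line differentiable_partials assms)
  also have "\<dots> = l * dy i K x y"
    using assms unfolding dy_def
    by (simp add: deriv_line_eq_frechet_derivative differentiable_partials power2_eq_square
        linear_cmul[OF linear_frechet_derivative[OF differentiable_partials(1)[OF assms(1,2)]]])
  finally show ?thesis .
qed

lemma Euler_energy:
  assumes "x \<in> U" "y \<noteq> 0"
  shows "(\<Sum>i\<in>UNIV. y $ i * dy i K x y) = 2 * K x y"
  using Euler_homogeneous[OF differentiable_partials(1)[OF assms], of 2] homogeneous[OF assms(1)]
  by (simp add: dy_def)

text \<open>The contracted index is the one of the outer derivative, so that this is Euler's relation for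
  the function \<open>dy j K x\<close>.\<close>

lemma Euler_dy:
  assumes "x \<in> U" "y \<noteq> 0"
  shows "(\<Sum>i\<in>UNIV. y $ i * dy i (dy j K) x y) = dy j K x y"
  using Euler_homogeneous[OF differentiable_partials(3)[OF assms, of j], of 1] dy_homogeneous[OF assms]
  by (simp add: dy_def)

lemma Euler_dx:
  assumes "x \<in> U" "y \<noteq> 0"
  shows "(\<Sum>i\<in>UNIV. y $ i * dy i (dx j K) x y) = 2 * dx j K x y"
  using Euler_homogeneous[OF differentiable_partials(2)[OF assms, of j], of 2] dx_homogeneous[OF assms]
  by (simp add: dy_def)

lemma hessian_kernel:
  assumes "x \<in> U" "y \<noteq> 0" "fiber_hessian K x y *v z = 0"
  shows "z = 0"
  using hessian_pos[OF assms(1,2), of z] assms(3) by auto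

lemma hessian_mult_spray:
  assumes "x \<in> U" "y \<noteq> 0"
  shows "(\<Sum>j\<in>UNIV. dy i (dy j K) x y * (2 * spray_coeff K j x y)) = euler_lagrange K i x y"
proof -
  let ?M = "fiber_hessian K x y" and ?E = "\<chi> i. euler_lagrange K i x y"
  have "(\<chi> j. 2 * spray_coeff K j x y) = matrix_inv ?M *v ?E"
    by (simp add: vec_eq_iff spray_coeff_def matrix_vector_mult_def)
  then have "?M *v (\<chi> j. 2 * spray_coeff K j x y) = ?E"
    using matrix_inv_mult(1)[OF matrix_invertible_if_trivial_kernel[OF hessian_kernel[OF assms]]]
    by (simp add: matrix_vector_mul_assoc)
  from arg_cong[OF this, of "\<lambda>v. v $ i"] show ?thesis
    by (simp add: matrix_vector_mult_def fiber_hessian_def)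
qed

text \<open>Contraction with \<open>y^i\<close>, by Euler's relations for \<open>K\<close> and for \<open>K_j\<close>. Equations of this form
  are the two halves of the kernel equation for the Hessian of a product.\<close>

lemma contract_with_position:
  assumes "x \<in> U" "y \<noteq> 0"
    and "\<And>i. dy i K x y * A + c * (\<Sum>j\<in>UNIV. dy i (dy j K) x y * z j) = 0"
  shows "2 * K x y * A + c * (\<Sum>j\<in>UNIV. dy j K x y * z j) = 0"
proof -
  have "0 = (\<Sum>i\<in>UNIV. y $ i * (dy i K x y * A + c * (\<Sum>j\<in>UNIV. dy i (dy j K) x y * z j)))"
    by (simp add: assms(3))
  also have "\<dots> = (\<Sum>i\<in>UNIV. y $ i * dy i K x y) * A
      + c * (\<Sum>i\<in>UNIV. \<Sum>j\<in>UNIV. y $ i * dy i (dy j K) x y * z j)"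
    by (simp add: distrib_left sum.distrib sum_distrib_left sum_distrib_right ac_simps)
  also have "\<dots> = (\<Sum>i\<in>UNIV. y $ i * dy i K x y) * A
      + c * (\<Sum>j\<in>UNIV. (\<Sum>i\<in>UNIV. y $ i * dy i (dy j K) x y) * z j)"
    by (subst sum.swap) (simp add: sum_distrib_right)
  finally show ?thesis
    by (simp only: Euler_dy[OF assms(1,2)] Euler_energy[OF assms(1,2)])
qed

text \<open>Conservation of energy: the geodesic vector field \<open>y^k \<partial>/\<partial>x^k - 2 S^j \<partial>/\<partial>y^j\<close> annihilates
  \<open>K\<close>. Indeed \<open>K_j = y^i K_{ij}\<close>, so the left hand side is \<open>y^i E_i\<close>, and
  \<open>y^i K_{i;k} y^k = 2 K_{;k} y^k\<close> because \<open>K_{;k}\<close> is homogeneous of degree 2.\<close>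

lemma energy_preserved_by_spray:
  assumes "x \<in> U" "y \<noteq> 0"
  shows "(\<Sum>j\<in>UNIV. dy j K x y * (2 * spray_coeff K j x y)) = (\<Sum>k\<in>UNIV. dx k K x y * y $ k)"
proof -
  have "(\<Sum>j\<in>UNIV. dy j K x y * (2 * spray_coeff K j x y))
      = (\<Sum>j\<in>UNIV. (\<Sum>i\<in>UNIV. y $ i * dy i (dy j K) x y) * (2 * spray_coeff K j x y))"
    by (simp only: Euler_dy[OF assms])
  also have "\<dots> = (\<Sum>i\<in>UNIV. y $ i * (\<Sum>j\<in>UNIV. dy i (dy j K) x y * (2 * spray_coeff K j x y)))"
    unfolding sum_distrib_left sum_distrib_right by (subst sum.swap) (simp add: mult.assoc)
  also have "\<dots> = (\<Sum>i\<in>UNIV. y $ i * euler_lagrange K i x y)"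
    by (simp only: hessian_mult_spray[OF assms])
  also have "\<dots> = (\<Sum>i\<in>UNIV. \<Sum>k\<in>UNIV. y $ i * dy i (dx k K) x y * y $ k)
      - (\<Sum>i\<in>UNIV. y $ i * dx i K x y)"
    by (simp add: right_diff_distrib sum_subtractf sum_distrib_left mult.assoc)
  also have "(\<Sum>i\<in>UNIV. \<Sum>k\<in>UNIV. y $ i * dy i (dx k K) x y * y $ k)
      = (\<Sum>k\<in>UNIV. 2 * dx k K x y * y $ k)"
    by (subst sum.swap) (simp only: sum_distrib_right[symmetric] Euler_dx[OF assms])
  finally show ?thesis
    by (simp add: sum_subtractf[symmetric] algebra_simps sum_distrib_left[symmetric])
qed

end

section \<open>Product functions\<close>

definition pd1 :: "(real \<Rightarrow> real \<Rightarrow> real) \<Rightarrow> real \<Rightarrow> real \<Rightarrow> real" where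
  "pd1 \<phi> s t = deriv (\<lambda>s. \<phi> s t) s"

definition pd2 :: "(real \<Rightarrow> real \<Rightarrow> real) \<Rightarrow> real \<Rightarrow> real \<Rightarrow> real" where
  "pd2 \<phi> s t = deriv (\<lambda>t. \<phi> s t) t"

lemma DERIV_pd:
  assumes "(\<lambda>(s, t). \<phi> s t) differentiable (at (s, t))"
  shows "((\<lambda>s. \<phi> s t) has_field_derivative pd1 \<phi> s t) (at s)"
    and "((\<lambda>t. \<phi> s t) has_field_derivative pd2 \<phi> s t) (at t)"
  using differentiable_slices[OF assms] unfolding pd1_def pd2_def
  by (auto simp: DERIV_deriv_iff_real_differentiable)

text \<open>In this form the partial derivatives of a smooth function are differentiable by
  \<open>smooth_on_directional_deriv_differentiable\<close>.\<close>

lemma pd_eq_directional: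
  shows "pd1 \<phi> s t = deriv (\<lambda>h. (\<lambda>(s, t). \<phi> s t) ((s, t) + h *\<^sub>R (1, 0))) 0"
    and "pd2 \<phi> s t = deriv (\<lambda>h. (\<lambda>(s, t). \<phi> s t) ((s, t) + h *\<^sub>R (0, 1))) 0"
proof -
  have shift: "(g has_field_derivative D) (at a) \<longleftrightarrow>
      ((\<lambda>h. g (a + h)) has_field_derivative D) (at 0)" for g :: "real \<Rightarrow> real" and a D
    using DERIV_shift[of g D 0 a] by (simp add: add.commute)
  show "pd1 \<phi> s t = deriv (\<lambda>h. (\<lambda>(s, t). \<phi> s t) ((s, t) + h *\<^sub>R (1, 0))) 0"
    and "pd2 \<phi> s t = deriv (\<lambda>h. (\<lambda>(s, t). \<phi> s t) ((s, t) + h *\<^sub>R (0, 1))) 0"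
    by (simp_all add: pd1_def pd2_def deriv_def shift[where a = s] shift[where a = t])
qed

lemma has_derivative_pd:
  assumes "(\<lambda>(s, t). \<phi> s t) differentiable (at (s, t))"
  shows "((\<lambda>(s, t). \<phi> s t) has_derivative (\<lambda>(a, b). pd1 \<phi> s t * a + pd2 \<phi> s t * b)) (at (s, t))"
proof -
  let ?D = "frechet_derivative (\<lambda>(s, t). \<phi> s t) (at (s, t))"
  have lin: "linear ?D"
    by (rule linear_frechet_derivative[OF assms])
  have "?D (a, b) = pd1 \<phi> s t * a + pd2 \<phi> s t * b" for a b
  proof -
    have "?D (a, b) = ?D (a *\<^sub>R (1, 0) + b *\<^sub>R (0, 1))"
      by simp
    also have "\<dots> = a * ?D (1, 0) + b * ?D (0, 1)"
      unfolding linear_add[OF lin] linear_cmul[OF lin] by simp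
    finally show ?thesis
      unfolding pd_eq_directional deriv_line_eq_frechet_derivative[OF assms] by simp
  qed
  then have "?D = (\<lambda>(a, b). pd1 \<phi> s t * a + pd2 \<phi> s t * b)"
    by auto
  then show ?thesis
    using assms by (simp add: frechet_derivative_works)
qed

lemma DERIV_pd_compose:
  assumes "(\<lambda>(s, t). \<phi> s t) differentiable (at (a r, b r))"
    and "(a has_field_derivative a') (at r)" and "(b has_field_derivative b') (at r)"
  shows "((\<lambda>r. \<phi> (a r) (b r)) has_field_derivative
    pd1 \<phi> (a r) (b r) * a' + pd2 \<phi> (a r) (b r) * b') (at r)"
proof -
  have "((\<lambda>r. (a r, b r)) has_derivative (\<lambda>h. (a' * h, b' * h))) (at r)"
    using assms(2,3) by (intro has_derivative_Pair) (simp_all add: has_field_derivative_def)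
  from has_derivative_compose[OF this has_derivative_pd[OF assms(1)]]
  have "((\<lambda>r. \<phi> (a r) (b r)) has_derivative
      (\<lambda>h. pd1 \<phi> (a r) (b r) * (a' * h) + pd2 \<phi> (a r) (b r) * (b' * h))) (at r)"
    by simp
  then show ?thesis
    unfolding has_field_derivative_def by (rule has_derivative_eq_rhs) (simp add: fun_eq_iff algebra_simps)
qed

lemma product_function_differentiable:
  assumes "product_function f" "s > 0" "t > 0"
  shows "(\<lambda>(s, t). f s t) differentiable (at (s, t))"
    and "(\<lambda>(s, t). pd1 f s t) differentiable (at (s, t))"
    and "(\<lambda>(s, t). pd2 f s t) differentiable (at (s, t))"
proof -
  have sm: "smooth_on ({0<..} \<times> {0<..}) (\<lambda>(s, t). f s t)"
    using assms(1) unfolding product_function_def by blast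
  have st: "(s, t) \<in> {0<..} \<times> {0<..}"
    using assms by simp
  show "(\<lambda>(s, t). f s t) differentiable (at (s, t))"
    by (rule smooth_on_imp_differentiable[OF sm st])
  show "(\<lambda>(s, t). pd1 f s t) differentiable (at (s, t))"
    unfolding pd_eq_directional
    using smooth_on_directional_deriv_differentiable[OF sm st, of "(1, 0)"]
    by (simp add: case_prod_beta')
  show "(\<lambda>(s, t). pd2 f s t) differentiable (at (s, t))"
    unfolding pd_eq_directional
    using smooth_on_directional_deriv_differentiable[OF sm st, of "(0, 1)"]
    by (simp add: case_prod_beta')
qed

lemma eventually_pos_nhds:
  fixes a :: real
  assumes "a > 0"
  shows "eventually (\<lambda>r. r > 0) (nhds a)"
  using eventually_nhds_in_open[of "{0<..}" a] assms by simp

lemma product_function_homogeneous: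
  assumes "product_function f" "l > 0" "s > 0" "t > 0"
  shows "f (l * s) (l * t) = l * f s t"
  using assms unfolding product_function_def by (meson less_imp_le)

lemma product_function_Euler:
  assumes f: "product_function f" and "s > 0" "t > 0"
  shows "s * pd1 f s t + t * pd2 f s t = f s t"
proof -
  have hom: "f (l * s) (l * t) = l * f s t" if "l > 0" for l
    using that assms(2,3) by (rule product_function_homogeneous[OF f])
  have "((\<lambda>l. f (l * s) (l * t)) has_field_derivative
      pd1 f (1 * s) (1 * t) * s + pd2 f (1 * s) (1 * t) * t) (at 1)"
    using product_function_differentiable(1)[OF f assms(2,3)]
    by (intro DERIV_pd_compose) (auto intro!: derivative_eq_intros)
  moreover have "((\<lambda>l. f (l * s) (l * t)) has_field_derivative f s t) (at 1)"
  proof (rule DERIV_cong_ev[THEN iffD2, OF refl _ refl])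
    show "eventually (\<lambda>l. f (l * s) (l * t) = l * f s t) (nhds 1)"
      using eventually_pos_nhds[OF zero_less_one] by (rule eventually_mono) (rule hom)
  qed (auto intro!: derivative_eq_intros)
  ultimately have "pd1 f (1 * s) (1 * t) * s + pd2 f (1 * s) (1 * t) * t = f s t"
    by (rule DERIV_unique)
  then show ?thesis
    by (simp add: mult.commute)
qed

text \<open>Differentiate \<open>f (s', l t) = l f (s' / l, t)\<close> at \<open>s' = l s\<close>.\<close>

lemma product_function_pd_homogeneous:
  assumes f: "product_function f" and "s > 0" "t > 0" "l > 0"
  shows "pd1 f (l * s) (l * t) = pd1 f s t"
proof -
  have "f s' (l * t) = l * f (s' / l) t" if "s' > 0" for s'
  proof -
    have "f (l * (s' / l)) (l * t) = l * f (s' / l) t"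
      using assms that by (intro product_function_homogeneous[OF f]) auto
    then show ?thesis
      using assms by simp
  qed
  then have ev: "eventually (\<lambda>s'. f s' (l * t) = l * f (s' / l) t) (nhds (l * s))"
    using eventually_pos_nhds[of "l * s"] assms by (auto elim!: eventually_mono)
  have "((\<lambda>s. f s t) has_field_derivative pd1 f s t) (at ((l * s) / l))"
    using DERIV_pd(1)[OF product_function_differentiable(1)[OF assms(1-3)]] assms by simp
  moreover have "((\<lambda>s'. s' / l) has_field_derivative 1 / l) (at (l * s))"
    using assms by (auto intro!: derivative_eq_intros)
  ultimately have "((\<lambda>s'. f (s' / l) t) has_field_derivative pd1 f s t * (1 / l)) (at (l * s))"
    by (rule DERIV_chain2[where f = "\<lambda>s. f s t" and g = "\<lambda>s'. s' / l"])
  from DERIV_cmult[OF this, of l]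
  have "((\<lambda>s'. l * f (s' / l) t) has_field_derivative pd1 f s t) (at (l * s))"
    using assms by simp
  with ev have "((\<lambda>s'. f s' (l * t)) has_field_derivative pd1 f s t) (at (l * s))"
    by (subst DERIV_cong_ev[OF refl _ refl])
  then show ?thesis
    unfolding pd1_def by (rule DERIV_imp_deriv)
qed

text \<open>The two derivatives of Euler's relation for \<open>f\<close>. The mixed derivatives agree since both equal
  \<open>- (s / t) f_{ss}\<close>: one by differentiating Euler's relation for \<open>f\<close> in \<open>s\<close>, the other by Euler's
  relation for \<open>f_s\<close>, which is homogeneous of degree 0.\<close>

lemma product_function_second_order:
  assumes f: "product_function f" and "s > 0" "t > 0"
  shows "pd2 (pd1 f) s t = pd1 (pd2 f) s t"
    and "s * pd1 (pd1 f) s t + t * pd1 (pd2 f) s t = 0"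
    and "s * pd1 (pd2 f) s t + t * pd2 (pd2 f) s t = 0"
proof -
  note D = product_function_differentiable[OF assms]
  note D1 = DERIV_pd[OF D(2)] and D2 = DERIV_pd[OF D(3)] and D0 = DERIV_pd[OF D(1)]
  have "((\<lambda>s. s * pd1 f s t + t * pd2 f s t) has_field_derivative
      1 * pd1 f s t + pd1 (pd1 f) s t * s + t * pd1 (pd2 f) s t) (at s)"
    by (intro DERIV_add DERIV_mult DERIV_cmult D1 D2 DERIV_ident)
  moreover have "((\<lambda>s. s * pd1 f s t + t * pd2 f s t) has_field_derivative pd1 f s t) (at s)"
  proof (rule DERIV_cong_ev[THEN iffD2, OF refl _ refl D0(1)])
    show "eventually (\<lambda>s. s * pd1 f s t + t * pd2 f s t = f s t) (nhds s)"
      using eventually_pos_nhds[OF assms(2)]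
      by (rule eventually_mono) (rule product_function_Euler[OF f _ assms(3)])
  qed
  ultimately have "1 * pd1 f s t + pd1 (pd1 f) s t * s + t * pd1 (pd2 f) s t = pd1 f s t"
    by (rule DERIV_unique)
  then have E1: "s * pd1 (pd1 f) s t + t * pd1 (pd2 f) s t = 0"
    by (simp add: mult.commute)
  have "((\<lambda>t. s * pd1 f s t + t * pd2 f s t) has_field_derivative
      s * pd2 (pd1 f) s t + (1 * pd2 f s t + pd2 (pd2 f) s t * t)) (at t)"
    by (intro DERIV_add DERIV_mult DERIV_cmult D1 D2 DERIV_ident)
  moreover have "((\<lambda>t. s * pd1 f s t + t * pd2 f s t) has_field_derivative pd2 f s t) (at t)"
  proof (rule DERIV_cong_ev[THEN iffD2, OF refl _ refl D0(2)])
    show "eventually (\<lambda>t. s * pd1 f s t + t * pd2 f s t = f s t) (nhds t)"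
      using eventually_pos_nhds[OF assms(3)]
      by (rule eventually_mono) (rule product_function_Euler[OF f assms(2)])
  qed
  ultimately have "s * pd2 (pd1 f) s t + (1 * pd2 f s t + pd2 (pd2 f) s t * t) = pd2 f s t"
    by (rule DERIV_unique)
  then have E2: "s * pd2 (pd1 f) s t + t * pd2 (pd2 f) s t = 0"
    by (simp add: mult.commute)
  have "((\<lambda>l. pd1 f (l * s) (l * t)) has_field_derivative
      pd1 (pd1 f) (1 * s) (1 * t) * s + pd2 (pd1 f) (1 * s) (1 * t) * t) (at 1)"
    using D(2) by (intro DERIV_pd_compose) (auto intro!: derivative_eq_intros)
  moreover have "((\<lambda>l. pd1 f (l * s) (l * t)) has_field_derivative 0) (at 1)"
  proof (rule DERIV_cong_ev[THEN iffD2, OF refl _ refl DERIV_const])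
    show "eventually (\<lambda>l. pd1 f (l * s) (l * t) = pd1 f s t) (nhds 1)"
      using eventually_pos_nhds[OF zero_less_one]
      by (rule eventually_mono) (rule product_function_pd_homogeneous[OF assms])
  qed
  ultimately have "pd1 (pd1 f) (1 * s) (1 * t) * s + pd2 (pd1 f) (1 * s) (1 * t) * t = 0"
    by (rule DERIV_unique)
  then have "s * pd1 (pd1 f) s t + t * pd2 (pd1 f) s t = 0"
    by (simp add: mult.commute)
  with E1 have "t * pd2 (pd1 f) s t = t * pd1 (pd2 f) s t"
    by linarith
  with assms(3) show sym: "pd2 (pd1 f) s t = pd1 (pd2 f) s t"
    by simp
  show "s * pd1 (pd1 f) s t + t * pd1 (pd2 f) s t = 0"
    by (rule E1)
  show "s * pd1 (pd2 f) s t + t * pd2 (pd2 f) s t = 0"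
    using E2 sym by simp
qed

lemma product_function_nondegenerate:
  assumes "product_function f" "s > 0" "t > 0"
  shows "pd1 f s t \<noteq> 0" "pd2 f s t \<noteq> 0"
    and "pd1 f s t * pd2 f s t - 2 * f s t * pd1 (pd2 f) s t \<noteq> 0"
proof -
  have "pd1 (pd2 f) s t = deriv (\<lambda>s. deriv (\<lambda>t. f s t) t) s"
    by (simp add: pd1_def pd2_def)
  then show "pd1 f s t \<noteq> 0" "pd2 f s t \<noteq> 0"
    and "pd1 f s t * pd2 f s t - 2 * f s t * pd1 (pd2 f) s t \<noteq> 0"
    using assms unfolding product_function_def by (auto simp: pd1_def pd2_def)
qed

section \<open>Coordinates on a product\<close>

lemma coords_linear:
  "bounded_linear (left_coords :: real^('m::finite + 'n::finite) \<Rightarrow> real^'m)"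
  "bounded_linear (right_coords :: real^('m::finite + 'n::finite) \<Rightarrow> real^'n)"
  by (auto intro!: linearI linear_conv_bounded_linear[THEN iffD1]
      simp: left_coords_def right_coords_def vec_eq_iff)

lemmas linear_coords = coords_linear[THEN bounded_linear.linear]
lemmas coords_add_scale =
  linear_coords[THEN linear_add] linear_coords[THEN linear_cmul] linear_coords[THEN linear_0]

lemma coords_axis [simp]:
  "left_coords (axis (Inl i) 1) = axis i 1" "right_coords (axis (Inl i) 1) = 0"
  "left_coords (axis (Inr i') 1) = 0" "right_coords (axis (Inr i') 1) = axis i' 1"
  by (auto simp: left_coords_def right_coords_def vec_eq_iff axis_def)

lemma coords_join [simp]:
  "left_coords (join_coords x x') = x" "right_coords (join_coords x x') = x'"
  "join_coords (left_coords z) (right_coords z) = z"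
  by (auto simp: left_coords_def right_coords_def join_coords_def vec_eq_iff split: sum.split)

lemma join_coords_inject: "join_coords x x' = join_coords z z' \<longleftrightarrow> x = z \<and> x' = z'"
  by (metis coords_join(1,2))

lemma coords_nth: "left_coords z $ i = z $ Inl i" "right_coords z $ i' = z $ Inr i'"
  by (simp_all add: left_coords_def right_coords_def)

lemma sum_UNIV_Plus:
  fixes g :: "'m::finite + 'n::finite \<Rightarrow> real"
  shows "(\<Sum>\<alpha>\<in>UNIV. g \<alpha>) = (\<Sum>i\<in>UNIV. g (Inl i)) + (\<Sum>i'\<in>UNIV. g (Inr i'))"
  by (simp add: UNIV_Plus_UNIV[symmetric] sum.Plus del: UNIV_Plus_UNIV)

text \<open>Functions on a factor as functions of all coordinates. The partial derivatives of pull-backs are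
  then again pull-backs or zero, as identities of functions, so that rewriting computes
  iterated ones.\<close>

definition pull_left :: "(real^'m \<Rightarrow> real^'m \<Rightarrow> real) \<Rightarrow>
    real^('m::finite + 'n::finite) \<Rightarrow> real^('m + 'n) \<Rightarrow> real" where
  "pull_left g = (\<lambda>x y. g (left_coords x) (left_coords y))"

definition pull_right :: "(real^'n \<Rightarrow> real^'n \<Rightarrow> real) \<Rightarrow>
    real^('m::finite + 'n::finite) \<Rightarrow> real^('m + 'n) \<Rightarrow> real" where
  "pull_right g = (\<lambda>x y. g (right_coords x) (right_coords y))"

lemma pull_left_apply: "pull_left g x y = g (left_coords x) (left_coords y)"
  and pull_right_apply: "pull_right g' x y = g' (right_coords x) (right_coords y)"
  by (simp_all add: pull_left_def pull_right_def)

lemma partials_const [simp]: "dx \<alpha> (\<lambda>_ _. c) = (\<lambda>_ _. 0)" "dy \<alpha> (\<lambda>_ _. c) = (\<lambda>_ _. 0)"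
  by (simp_all add: dx_def dy_def fun_eq_iff)

lemma partials_pull_left [simp]:
  "dx (Inl i) (pull_left g) = pull_left (dx i g)" "dx (Inr i') (pull_left g) = (\<lambda>_ _. 0)"
  "dy (Inl i) (pull_left g) = pull_left (dy i g)" "dy (Inr i') (pull_left g) = (\<lambda>_ _. 0)"
  by (simp_all add: pull_left_def dx_def dy_def fun_eq_iff coords_add_scale)

lemma partials_pull_right [simp]:
  "dx (Inl i) (pull_right g) = (\<lambda>_ _. 0)" "dx (Inr i') (pull_right g) = pull_right (dx i' g)"
  "dy (Inl i) (pull_right g) = (\<lambda>_ _. 0)" "dy (Inr i') (pull_right g) = pull_right (dy i' g)"
  by (simp_all add: pull_right_def dx_def dy_def fun_eq_iff coords_add_scale)

section \<open>The spray of a Minkowskian product\<close>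

text \<open>The product in coordinates, free of manifolds: \<open>energy_eq\<close> is only available over the chart
  domains, so all derivatives of \<open>G\<close> are taken locally.\<close>

locale minkowskian_product_energy =
  K: finsler_energy U1 K + H: finsler_energy U2 H
  for U1 :: "(real^'m::finite) set" and K and U2 :: "(real^'n::finite) set" and H +
  fixes f :: "real \<Rightarrow> real \<Rightarrow> real" and G :: "real^('m + 'n) \<Rightarrow> real^('m + 'n) \<Rightarrow> real"
  assumes product_function: "product_function f"
    and energy_eq: "\<And>x y. left_coords x \<in> U1 \<Longrightarrow> right_coords x \<in> U2 \<Longrightarrow>
      G x y = f (K (left_coords x) (left_coords y)) (H (right_coords x) (right_coords y))"
begin

abbreviation k where "k \<equiv> pull_left K"
abbreviation h where "h \<equiv> pull_right H"

definition base :: "(real^('m + 'n)) set" where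
  "base = {x. left_coords x \<in> U1 \<and> right_coords x \<in> U2}"

definition fiber :: "(real^('m + 'n)) set" where
  "fiber = {y. left_coords y \<noteq> 0 \<and> right_coords y \<noteq> 0}"

lemma open_base: "open base" and open_fiber: "open fiber"
proof -
  note cont = coords_linear[THEN linear_continuous_on]
  have base: "base = left_coords -` U1 \<inter> right_coords -` U2"
    and fiber: "fiber = left_coords -` (- {0}) \<inter> right_coords -` (- {0})"
    by (auto simp: base_def fiber_def)
  show "open base" "open fiber"
    unfolding base fiber
    by (intro open_Int open_vimage cont K.open_base H.open_base open_Compl closed_singleton)+
qed

lemma components_pos:
  assumes "x \<in> base" "y \<in> fiber"
  shows "k x y > 0" "h x y > 0"
  using assms K.energy_pos H.energy_pos by (auto simp: base_def fiber_def pull_left_apply pull_right_apply)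

text \<open>Coordinate lines of the product project to lines in the factors.\<close>

lemma DERIV_coords:
  fixes g :: "real^'m \<Rightarrow> real" and g' :: "real^'n \<Rightarrow> real" and z :: "real^('m + 'n)"
  shows "g differentiable (at (left_coords z)) \<Longrightarrow>
      ((\<lambda>t. g (left_coords (z + t *\<^sub>R axis \<alpha> 1))) has_field_derivative
        deriv (\<lambda>t. g (left_coords (z + t *\<^sub>R axis \<alpha> 1))) 0) (at 0)"
    and "g' differentiable (at (right_coords z)) \<Longrightarrow>
      ((\<lambda>t. g' (right_coords (z + t *\<^sub>R axis \<alpha> 1))) has_field_derivative
        deriv (\<lambda>t. g' (right_coords (z + t *\<^sub>R axis \<alpha> 1))) 0) (at 0)"
  unfolding coords_add_scale
  by (simp_all only: deriv_line_eq_frechet_derivative differentiable_imp_DERIV_line)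

lemma DERIV_components_fiber:
  assumes "x \<in> base" "y \<in> fiber"
  shows "((\<lambda>t. k x (y + t *\<^sub>R axis \<alpha> 1)) has_field_derivative dy \<alpha> k x y) (at 0)"
    and "((\<lambda>t. h x (y + t *\<^sub>R axis \<alpha> 1)) has_field_derivative dy \<alpha> h x y) (at 0)"
    and "((\<lambda>t. dx \<beta> k x (y + t *\<^sub>R axis \<alpha> 1)) has_field_derivative dy \<alpha> (dx \<beta> k) x y) (at 0)"
    and "((\<lambda>t. dx \<beta> h x (y + t *\<^sub>R axis \<alpha> 1)) has_field_derivative dy \<alpha> (dx \<beta> h) x y) (at 0)"
    and "((\<lambda>t. dy \<beta> k x (y + t *\<^sub>R axis \<alpha> 1)) has_field_derivative dy \<alpha> (dy \<beta> k) x y) (at 0)"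
    and "((\<lambda>t. dy \<beta> h x (y + t *\<^sub>R axis \<alpha> 1)) has_field_derivative dy \<alpha> (dy \<beta> h) x y) (at 0)"
proof -
  have l: "left_coords x \<in> U1" "left_coords y \<noteq> 0" and r: "right_coords x \<in> U2" "right_coords y \<noteq> 0"
    using assms by (auto simp: base_def fiber_def)
  note D = K.differentiable_partials(1-3)[OF l, THEN DERIV_coords(1)]
    H.differentiable_partials(1-3)[OF r, THEN DERIV_coords(2)]
  show "((\<lambda>t. k x (y + t *\<^sub>R axis \<alpha> 1)) has_field_derivative dy \<alpha> k x y) (at 0)"
    and "((\<lambda>t. h x (y + t *\<^sub>R axis \<alpha> 1)) has_field_derivative dy \<alpha> h x y) (at 0)"
    using D by (simp_all add: dy_def[of \<alpha>] pull_left_apply pull_right_apply)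
  show "((\<lambda>t. dx \<beta> k x (y + t *\<^sub>R axis \<alpha> 1)) has_field_derivative dy \<alpha> (dx \<beta> k) x y) (at 0)"
    by (cases \<beta>) (use D in \<open>simp_all add: dy_def[of \<alpha>] pull_left_apply\<close>)
  show "((\<lambda>t. dx \<beta> h x (y + t *\<^sub>R axis \<alpha> 1)) has_field_derivative dy \<alpha> (dx \<beta> h) x y) (at 0)"
    by (cases \<beta>) (use D in \<open>simp_all add: dy_def[of \<alpha>] pull_right_apply\<close>)
  show "((\<lambda>t. dy \<beta> k x (y + t *\<^sub>R axis \<alpha> 1)) has_field_derivative dy \<alpha> (dy \<beta> k) x y) (at 0)"
    by (cases \<beta>) (use D in \<open>simp_all add: dy_def[of \<alpha>] pull_left_apply\<close>)
  show "((\<lambda>t. dy \<beta> h x (y + t *\<^sub>R axis \<alpha> 1)) has_field_derivative dy \<alpha> (dy \<beta> h) x y) (at 0)"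
    by (cases \<beta>) (use D in \<open>simp_all add: dy_def[of \<alpha>] pull_right_apply\<close>)
qed

lemma DERIV_components_base:
  assumes "x \<in> base" "y \<in> fiber"
  shows "((\<lambda>t. k (x + t *\<^sub>R axis \<alpha> 1) y) has_field_derivative dx \<alpha> k x y) (at 0)"
    and "((\<lambda>t. h (x + t *\<^sub>R axis \<alpha> 1) y) has_field_derivative dx \<alpha> h x y) (at 0)"
proof -
  have l: "left_coords x \<in> U1" "left_coords y \<noteq> 0" and r: "right_coords x \<in> U2" "right_coords y \<noteq> 0"
    using assms by (auto simp: base_def fiber_def)
  show "((\<lambda>t. k (x + t *\<^sub>R axis \<alpha> 1) y) has_field_derivative dx \<alpha> k x y) (at 0)"
    and "((\<lambda>t. h (x + t *\<^sub>R axis \<alpha> 1) y) has_field_derivative dx \<alpha> h x y) (at 0)"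
    using K.differentiable_partials(4)[OF l, THEN DERIV_coords(1)]
      H.differentiable_partials(4)[OF r, THEN DERIV_coords(2)]
    by (simp_all add: dx_def pull_left_apply pull_right_apply)
qed

lemma DERIV_f_components:
  assumes "x \<in> base" "y \<in> fiber" "(\<lambda>(s, t). \<phi> s t) differentiable (at (k x y, h x y))"
  shows "((\<lambda>t. \<phi> (k x (y + t *\<^sub>R axis \<alpha> 1)) (h x (y + t *\<^sub>R axis \<alpha> 1))) has_field_derivative
    pd1 \<phi> (k x y) (h x y) * dy \<alpha> k x y + pd2 \<phi> (k x y) (h x y) * dy \<alpha> h x y) (at 0)"
  using DERIV_pd_compose[OF _ DERIV_components_fiber(1,2)[OF assms(1,2), of \<alpha>], of \<phi>] assms(3)
  by simp

lemma energy_eq_components: "x \<in> base \<Longrightarrow> G x y = f (k x y) (h x y)"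
  by (simp add: base_def energy_eq pull_left_apply pull_right_apply)

lemma dy_energy:
  assumes "x \<in> base" "y \<in> fiber"
  shows "dy \<alpha> G x y = pd1 f (k x y) (h x y) * dy \<alpha> k x y + pd2 f (k x y) (h x y) * dy \<alpha> h x y"
  unfolding dy_def[of \<alpha> G] energy_eq_components[OF assms(1)]
  by (intro DERIV_imp_deriv DERIV_f_components assms product_function_differentiable
      product_function components_pos)

lemma dx_energy:
  assumes "x \<in> base" "y \<in> fiber"
  shows "dx \<alpha> G x y = pd1 f (k x y) (h x y) * dx \<alpha> k x y + pd2 f (k x y) (h x y) * dx \<alpha> h x y"
  unfolding dx_def[of \<alpha> G]
proof (rule DERIV_imp_deriv, rule DERIV_cong_ev[THEN iffD2, OF refl _ refl])
  show "eventually (\<lambda>t. G (x + t *\<^sub>R axis \<alpha> 1) y =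
      f (k (x + t *\<^sub>R axis \<alpha> 1) y) (h (x + t *\<^sub>R axis \<alpha> 1) y)) (nhds 0)"
    using eventually_line_in_open[OF open_base assms(1), of "axis \<alpha> 1"]
    by (auto elim!: eventually_mono simp: energy_eq_components)
  show "((\<lambda>t. f (k (x + t *\<^sub>R axis \<alpha> 1) y) (h (x + t *\<^sub>R axis \<alpha> 1) y)) has_field_derivative
      pd1 f (k x y) (h x y) * dx \<alpha> k x y + pd2 f (k x y) (h x y) * dx \<alpha> h x y) (at 0)"
    using DERIV_pd_compose[OF _ DERIV_components_base[OF assms, of \<alpha>], of f]
      product_function_differentiable(1)[OF product_function components_pos[OF assms]]
    by simp
qed

text \<open>One computation for the Hessian and for the mixed derivatives in the Euler-Lagrange
  expression: \<open>P\<close> and \<open>Q\<close> stand for either fiber or base derivatives of the two components.\<close>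

lemma dy_of_first_derivative:
  assumes xy: "x \<in> base" "y \<in> fiber"
    and eq: "\<And>y. y \<in> fiber \<Longrightarrow> D x y = pd1 f (k x y) (h x y) * P x y + pd2 f (k x y) (h x y) * Q x y"
    and P: "((\<lambda>t. P x (y + t *\<^sub>R axis \<alpha> 1)) has_field_derivative dy \<alpha> P x y) (at 0)"
    and Q: "((\<lambda>t. Q x (y + t *\<^sub>R axis \<alpha> 1)) has_field_derivative dy \<alpha> Q x y) (at 0)"
  shows "dy \<alpha> D x y =
      (pd1 (pd1 f) (k x y) (h x y) * dy \<alpha> k x y + pd2 (pd1 f) (k x y) (h x y) * dy \<alpha> h x y) * P x y
    + pd1 f (k x y) (h x y) * dy \<alpha> P x y
    + (pd1 (pd2 f) (k x y) (h x y) * dy \<alpha> k x y + pd2 (pd2 f) (k x y) (h x y) * dy \<alpha> h x y) * Q x y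
    + pd2 f (k x y) (h x y) * dy \<alpha> Q x y"
proof -
  let ?y = "\<lambda>t. y + t *\<^sub>R axis \<alpha> (1::real)"
  note dif = product_function_differentiable[OF product_function components_pos[OF xy]]
  have "((\<lambda>t. pd1 f (k x (?y t)) (h x (?y t)) * P x (?y t) + pd2 f (k x (?y t)) (h x (?y t)) * Q x (?y t))
      has_field_derivative
        ((pd1 (pd1 f) (k x y) (h x y) * dy \<alpha> k x y + pd2 (pd1 f) (k x y) (h x y) * dy \<alpha> h x y) * P x (?y 0)
          + dy \<alpha> P x y * pd1 f (k x (?y 0)) (h x (?y 0)))
      + ((pd1 (pd2 f) (k x y) (h x y) * dy \<alpha> k x y + pd2 (pd2 f) (k x y) (h x y) * dy \<alpha> h x y) * Q x (?y 0)
          + dy \<alpha> Q x y * pd2 f (k x (?y 0)) (h x (?y 0)))) (at 0)"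
    by (intro DERIV_add DERIV_mult P Q DERIV_f_components[OF xy] dif)
  from DERIV_imp_deriv[OF this]
  have "deriv (\<lambda>t. pd1 f (k x (?y t)) (h x (?y t)) * P x (?y t) + pd2 f (k x (?y t)) (h x (?y t)) * Q x (?y t)) 0
      = (pd1 (pd1 f) (k x y) (h x y) * dy \<alpha> k x y + pd2 (pd1 f) (k x y) (h x y) * dy \<alpha> h x y) * P x y
        + pd1 f (k x y) (h x y) * dy \<alpha> P x y
        + (pd1 (pd2 f) (k x y) (h x y) * dy \<alpha> k x y + pd2 (pd2 f) (k x y) (h x y) * dy \<alpha> h x y) * Q x y
        + pd2 f (k x y) (h x y) * dy \<alpha> Q x y"
    by (simp add: mult.commute)
  moreover have "eventually (\<lambda>t. D x (?y t) = pd1 f (k x (?y t)) (h x (?y t)) * P x (?y t)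
      + pd2 f (k x (?y t)) (h x (?y t)) * Q x (?y t)) (nhds 0)"
    using eventually_line_in_open[OF open_fiber xy(2), of "axis \<alpha> 1"]
    by (auto elim!: eventually_mono simp: eq)
  note deriv_cong_ev[OF this refl]
  ultimately show ?thesis
    unfolding dy_def[of \<alpha> D] by (rule trans[rotated])
qed

lemma dy_dy_energy:
  assumes "x \<in> base" "y \<in> fiber"
  shows "dy \<alpha> (dy \<beta> G) x y =
      (pd1 (pd1 f) (k x y) (h x y) * dy \<alpha> k x y + pd2 (pd1 f) (k x y) (h x y) * dy \<alpha> h x y) * dy \<beta> k x y
    + pd1 f (k x y) (h x y) * dy \<alpha> (dy \<beta> k) x y
    + (pd1 (pd2 f) (k x y) (h x y) * dy \<alpha> k x y + pd2 (pd2 f) (k x y) (h x y) * dy \<alpha> h x y) * dy \<beta> h x y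
    + pd2 f (k x y) (h x y) * dy \<alpha> (dy \<beta> h) x y"
  by (rule dy_of_first_derivative[where D = "dy \<beta> G" and P = "dy \<beta> k" and Q = "dy \<beta> h"])
    (intro assms dy_energy DERIV_components_fiber; assumption)+

lemma dy_dx_energy:
  assumes "x \<in> base" "y \<in> fiber"
  shows "dy \<alpha> (dx \<beta> G) x y =
      (pd1 (pd1 f) (k x y) (h x y) * dy \<alpha> k x y + pd2 (pd1 f) (k x y) (h x y) * dy \<alpha> h x y) * dx \<beta> k x y
    + pd1 f (k x y) (h x y) * dy \<alpha> (dx \<beta> k) x y
    + (pd1 (pd2 f) (k x y) (h x y) * dy \<alpha> k x y + pd2 (pd2 f) (k x y) (h x y) * dy \<alpha> h x y) * dx \<beta> h x y
    + pd2 f (k x y) (h x y) * dy \<alpha> (dx \<beta> h) x y"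
  by (rule dy_of_first_derivative[where D = "dx \<beta> G" and P = "dx \<beta> k" and Q = "dx \<beta> h"])
    (intro assms dx_energy DERIV_components_fiber; assumption)+

text \<open>The next two expressions have the same shape. For \<open>z = 2 S\<close> their corresponding ingredients
  coincide, which is why the sprays of the factors form the spray of the product.\<close>

lemma energy_hessian_apply:
  fixes z :: "'m + 'n \<Rightarrow> real"
  assumes "x \<in> base" "y \<in> fiber"
  defines "a \<equiv> \<Sum>\<beta>\<in>UNIV. dy \<beta> k x y * z \<beta>" and "b \<equiv> \<Sum>\<beta>\<in>UNIV. dy \<beta> h x y * z \<beta>"
  shows "(\<Sum>\<beta>\<in>UNIV. dy \<alpha> (dy \<beta> G) x y * z \<beta>) =
      (pd1 (pd1 f) (k x y) (h x y) * dy \<alpha> k x y + pd2 (pd1 f) (k x y) (h x y) * dy \<alpha> h x y) * a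
    + pd1 f (k x y) (h x y) * (\<Sum>\<beta>\<in>UNIV. dy \<alpha> (dy \<beta> k) x y * z \<beta>)
    + (pd1 (pd2 f) (k x y) (h x y) * dy \<alpha> k x y + pd2 (pd2 f) (k x y) (h x y) * dy \<alpha> h x y) * b
    + pd2 f (k x y) (h x y) * (\<Sum>\<beta>\<in>UNIV. dy \<alpha> (dy \<beta> h) x y * z \<beta>)"
  unfolding dy_dy_energy[OF assms(1,2)] a_def b_def
  by (simp only: distrib_right sum.distrib sum_distrib_left mult.assoc)

lemma energy_euler_lagrange:
  assumes "x \<in> base" "y \<in> fiber"
  defines "a \<equiv> \<Sum>\<gamma>\<in>UNIV. dx \<gamma> k x y * y $ \<gamma>" and "b \<equiv> \<Sum>\<gamma>\<in>UNIV. dx \<gamma> h x y * y $ \<gamma>"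
  shows "euler_lagrange G \<alpha> x y =
      (pd1 (pd1 f) (k x y) (h x y) * dy \<alpha> k x y + pd2 (pd1 f) (k x y) (h x y) * dy \<alpha> h x y) * a
    + pd1 f (k x y) (h x y) * euler_lagrange k \<alpha> x y
    + (pd1 (pd2 f) (k x y) (h x y) * dy \<alpha> k x y + pd2 (pd2 f) (k x y) (h x y) * dy \<alpha> h x y) * b
    + pd2 f (k x y) (h x y) * euler_lagrange h \<alpha> x y"
  unfolding dy_dx_energy[OF assms(1,2)] dx_energy[OF assms(1,2)] a_def b_def right_diff_distrib
  by (simp only: distrib_right sum.distrib sum_distrib_left mult.assoc)

text \<open>Contracting the kernel equation with the two halves of \<open>y\<close> leaves a homogeneous \<open>2 \<times> 2\<close> system
  for \<open>a = dK (z)\<close> and \<open>b = dH (z)\<close>. After elimination of \<open>f_{ss}\<close> and \<open>f_{tt}\<close> by homogeneity its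
  determinant is \<open>f_s f_t - 2 (s f_s + t f_t) f_{st} = f_s f_t - 2 f f_{st}\<close>. Once \<open>a = b = 0\<close>,
  the two halves of \<open>z\<close> lie in the kernels of the Hessians of \<open>K\<close> and \<open>H\<close>.\<close>

lemma energy_hessian_kernel:
  assumes xy: "x \<in> base" "y \<in> fiber" and z: "fiber_hessian G x y *v z = 0"
  shows "z = 0"
proof -
  define a where "a = (\<Sum>\<beta>\<in>UNIV. dy \<beta> k x y * z $ \<beta>)"
  define b where "b = (\<Sum>\<beta>\<in>UNIV. dy \<beta> h x y * z $ \<beta>)"
  define s t where "s = k x y" and "t = h x y"
  have l: "left_coords x \<in> U1" "left_coords y \<noteq> 0" and r: "right_coords x \<in> U2" "right_coords y \<noteq> 0"
    using xy by (auto simp: base_def fiber_def)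
  have st: "s > 0" "t > 0"
    using components_pos[OF xy] by (simp_all add: s_def t_def)
  have st_eq: "s = K (left_coords x) (left_coords y)" "t = H (right_coords x) (right_coords y)"
    by (simp_all add: s_def t_def pull_left_apply pull_right_apply)
  have a: "a = (\<Sum>j\<in>UNIV. dy j K (left_coords x) (left_coords y) * left_coords z $ j)"
    and b: "b = (\<Sum>j\<in>UNIV. dy j H (right_coords x) (right_coords y) * right_coords z $ j)"
    by (simp_all add: a_def b_def sum_UNIV_Plus coords_nth pull_left_apply pull_right_apply)
  define A where "A = pd1 (pd1 f) s t * a + pd1 (pd2 f) s t * b"
  define B where "B = pd1 (pd2 f) s t * a + pd2 (pd2 f) s t * b"
  note second = product_function_second_order[OF product_function st]
  have ker: "0 = (pd1 (pd1 f) s t * dy \<alpha> k x y + pd2 (pd1 f) s t * dy \<alpha> h x y) * a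
    + pd1 f s t * (\<Sum>\<beta>\<in>UNIV. dy \<alpha> (dy \<beta> k) x y * z $ \<beta>)
    + (pd1 (pd2 f) s t * dy \<alpha> k x y + pd2 (pd2 f) s t * dy \<alpha> h x y) * b
    + pd2 f s t * (\<Sum>\<beta>\<in>UNIV. dy \<alpha> (dy \<beta> h) x y * z $ \<beta>)" for \<alpha>
    using arg_cong[OF z, of "\<lambda>v. v $ \<alpha>"] energy_hessian_apply[OF xy, of \<alpha> "\<lambda>\<beta>. z $ \<beta>"]
    by (simp add: matrix_vector_mult_def fiber_hessian_def a_def b_def s_def t_def)
  have kerK: "dy i K (left_coords x) (left_coords y) * A + pd1 f s t *
      (\<Sum>j\<in>UNIV. dy i (dy j K) (left_coords x) (left_coords y) * left_coords z $ j) = 0" for i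
    using ker[of "Inl i"]
    by (simp add: sum_UNIV_Plus coords_nth pull_left_apply A_def algebra_simps)
  have kerH: "dy i H (right_coords x) (right_coords y) * B + pd2 f s t *
      (\<Sum>j\<in>UNIV. dy i (dy j H) (right_coords x) (right_coords y) * right_coords z $ j) = 0" for i
    using ker[of "Inr i"]
    by (simp add: sum_UNIV_Plus coords_nth pull_right_apply B_def second(1) algebra_simps)
  have eq1: "2 * s * A + pd1 f s t * a = 0"
    unfolding st_eq(1) a
    by (rule K.contract_with_position[OF l kerK[unfolded st_eq(1)]])
  have eq2: "2 * t * B + pd2 f s t * b = 0"
    unfolding st_eq(2) b
    by (rule H.contract_with_position[OF r kerH[unfolded st_eq(2)]])
  let ?fs = "pd1 f s t" and ?ft = "pd2 f s t" and ?c = "pd1 (pd2 f) s t"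
  have row1: "(?fs - 2 * t * ?c) * a + 2 * s * ?c * b = 0"
  proof -
    have "2 * (s * pd1 (pd1 f) s t + t * ?c) * a = 0"
      using second(2) by simp
    with eq1 show ?thesis
      by (simp add: A_def algebra_simps)
  qed
  have row2: "2 * t * ?c * a + (?ft - 2 * s * ?c) * b = 0"
  proof -
    have "2 * (s * ?c + t * pd2 (pd2 f) s t) * b = 0"
      using second(3) by simp
    with eq2 show ?thesis
      by (simp add: B_def algebra_simps)
  qed
  \<comment> \<open>Cramer's rule for the system \<open>row1\<close>, \<open>row2\<close>.\<close>
  define \<Delta> where "\<Delta> = (?fs - 2 * t * ?c) * (?ft - 2 * s * ?c) - (2 * s * ?c) * (2 * t * ?c)"
  have "\<Delta> = ?fs * ?ft - 2 * (s * ?fs + t * ?ft) * ?c"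
    by (simp add: \<Delta>_def algebra_simps)
  then have \<Delta>: "\<Delta> \<noteq> 0"
    using product_function_nondegenerate(3)[OF product_function st]
    by (simp add: product_function_Euler[OF product_function st])
  have "\<Delta> * a = (?ft - 2 * s * ?c) * ((?fs - 2 * t * ?c) * a + 2 * s * ?c * b)
      - 2 * s * ?c * (2 * t * ?c * a + (?ft - 2 * s * ?c) * b)"
    by (simp add: \<Delta>_def algebra_simps)
  then have a0: "a = 0"
    using \<Delta> unfolding row1 row2 by simp
  have "\<Delta> * b = (?fs - 2 * t * ?c) * (2 * t * ?c * a + (?ft - 2 * s * ?c) * b)
      - 2 * t * ?c * ((?fs - 2 * t * ?c) * a + 2 * s * ?c * b)"
    by (simp add: \<Delta>_def algebra_simps)
  then have b0: "b = 0"
    using \<Delta> unfolding row1 row2 by simp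
  have "fiber_hessian K (left_coords x) (left_coords y) *v left_coords z = 0"
    using kerK product_function_nondegenerate(1)[OF product_function st]
    by (simp add: A_def a0 b0 vec_eq_iff matrix_vector_mult_def fiber_hessian_def)
  moreover have "fiber_hessian H (right_coords x) (right_coords y) *v right_coords z = 0"
    using kerH product_function_nondegenerate(2)[OF product_function st]
    by (simp add: B_def a0 b0 vec_eq_iff matrix_vector_mult_def fiber_hessian_def)
  ultimately have "left_coords z = 0" "right_coords z = 0"
    using K.hessian_kernel[OF l] H.hessian_kernel[OF r] by blast+
  then have "z $ \<alpha> = 0" for \<alpha>
    by (cases \<alpha>) (metis coords_nth zero_index)+
  then show ?thesis
    by (simp add: vec_eq_iff)
qed

definition product_spray :: "real^('m + 'n) \<Rightarrow> real^('m + 'n) \<Rightarrow> 'm + 'n \<Rightarrow> real" where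
  "product_spray x y = (\<lambda>\<alpha>. case \<alpha> of
      Inl i \<Rightarrow> spray_coeff K i (left_coords x) (left_coords y)
    | Inr i' \<Rightarrow> spray_coeff H i' (right_coords x) (right_coords y))"

lemma spray_of_product:
  assumes xy: "x \<in> base" "y \<in> fiber"
  shows "spray_coeff G \<alpha> x y = product_spray x y \<alpha>"
proof (rule spray_coeff_unique)
  show "z = 0" if "fiber_hessian G x y *v z = 0" for z
    by (rule energy_hessian_kernel[OF xy that])
  have l: "left_coords x \<in> U1" "left_coords y \<noteq> 0" and r: "right_coords x \<in> U2" "right_coords y \<noteq> 0"
    using xy by (auto simp: base_def fiber_def)
  note simps = sum_UNIV_Plus product_spray_def coords_nth[symmetric] pull_left_apply pull_right_apply
  have "(\<Sum>\<beta>\<in>UNIV. dy \<beta> k x y * (2 * product_spray x y \<beta>)) = (\<Sum>\<gamma>\<in>UNIV. dx \<gamma> k x y * y $ \<gamma>)"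
    "(\<Sum>\<beta>\<in>UNIV. dy \<beta> h x y * (2 * product_spray x y \<beta>)) = (\<Sum>\<gamma>\<in>UNIV. dx \<gamma> h x y * y $ \<gamma>)"
    using K.energy_preserved_by_spray[OF l] H.energy_preserved_by_spray[OF r] by (simp_all add: simps)
  moreover have "(\<Sum>\<beta>\<in>UNIV. dy \<alpha> (dy \<beta> k) x y * (2 * product_spray x y \<beta>)) = euler_lagrange k \<alpha> x y"
    "(\<Sum>\<beta>\<in>UNIV. dy \<alpha> (dy \<beta> h) x y * (2 * product_spray x y \<beta>)) = euler_lagrange h \<alpha> x y" for \<alpha>
    using K.hessian_mult_spray[OF l] H.hessian_mult_spray[OF r] by (cases \<alpha>; simp add: simps)+
  ultimately show "(\<Sum>\<beta>\<in>UNIV. dy \<alpha> (dy \<beta> G) x y * (2 * product_spray x y \<beta>)) = euler_lagrange G \<alpha> x y"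
    for \<alpha>
    by (simp only: energy_hessian_apply[OF xy] energy_euler_lagrange[OF xy])
qed

text \<open>Differentiation along the fiber needs the splitting of the spray not only at \<open>y\<close>, but on the
  whole open set of fiber coordinates with both halves nonzero.\<close>

lemma cartan_coeff_of_product:
  assumes xy: "x \<in> base" "y \<in> fiber"
  shows "cartan_coeff G (Inl i) (Inl j) x y = cartan_coeff K i j (left_coords x) (left_coords y)"
    and "cartan_coeff G (Inr i') (Inr j') x y = cartan_coeff H i' j' (right_coords x) (right_coords y)"
    and "cartan_coeff G (Inr i') (Inl j) x y = 0"
    and "cartan_coeff G (Inl i) (Inr j') x y = 0"
proof -
  have "dy \<beta> (spray_coeff G \<alpha>) x y = dy \<beta> (\<lambda>x y. product_spray x y \<alpha>) x y" for \<alpha> \<beta>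
    unfolding dy_def
    by (rule deriv_cong_ev)
      (use eventually_line_in_open[OF open_fiber xy(2), of "axis \<beta> 1"] in
        \<open>auto elim!: eventually_mono simp: spray_of_product[OF xy(1)]\<close>)
  then show "cartan_coeff G (Inl i) (Inl j) x y = cartan_coeff K i j (left_coords x) (left_coords y)"
    and "cartan_coeff G (Inr i') (Inr j') x y = cartan_coeff H i' j' (right_coords x) (right_coords y)"
    and "cartan_coeff G (Inr i') (Inl j) x y = 0"
    and "cartan_coeff G (Inl i) (Inr j') x y = 0"
    by (simp_all add: cartan_coeff_def product_spray_def dy_def coords_add_scale)
qed

end

section \<open>Tangent vectors in charts\<close>

locale manifold =
  fixes X :: "'a topology" and A :: "('a, 'm::finite) chart set"
  assumes smooth_manifold: "smooth_manifold X A"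
begin

lemma chart_inj:
  assumes "c \<in> A"
  shows "inj_on (snd c) (fst c)"
proof -
  have "is_chart X c"
    using smooth_manifold assms unfolding smooth_manifold_def by blast
  then have "openin X (fst c)" and "inj_on (snd c) (topspace (subtopology X (fst c)))"
    unfolding is_chart_def by (blast intro: homeomorphic_imp_injective_map)+
  then show ?thesis
    using openin_subset[of X "fst c"] by (simp add: Int_absorb1)
qed

lemma open_chart_image:
  assumes "c \<in> A"
  shows "open (snd c ` fst c)"
  using smooth_manifold assms unfolding smooth_manifold_def is_chart_def by blast

lemma chart_inv_chart:
  assumes "c \<in> A" "p \<in> fst c"
  shows "chart_inv c (snd c p) = p"
  using assms chart_inj by (simp add: chart_inv_def)

lemma transition_differentiable:
  assumes "c \<in> charts_at A p" "d \<in> charts_at A p"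
  shows "snd d \<circ> chart_inv c differentiable (at (snd c p))"
    and "open (snd c ` (fst c \<inter> fst d))"
proof -
  have "smooth_on (snd c ` (fst c \<inter> fst d)) (snd d \<circ> chart_inv c)"
    using smooth_manifold assms unfolding smooth_manifold_def charts_at_def by blast
  then show "snd d \<circ> chart_inv c differentiable (at (snd c p))" "open (snd c ` (fst c \<inter> fst d))"
    using assms by (auto simp: charts_at_def smooth_on_def intro!: smooth_on_imp_differentiable)
qed

lemma transition_has_derivative:
  assumes "c \<in> charts_at A p" "d \<in> charts_at A p"
  shows "(snd d \<circ> chart_inv c has_derivative frechet_derivative (snd d \<circ> chart_inv c) (at (snd c p)))
    (at (snd c p))"
  using transition_differentiable(1)[OF assms] by (simp add: frechet_derivative_works)

text \<open>The chain rule, as the transition from \<open>c\<close> to \<open>e\<close> factors near \<open>p\<close> through \<open>d\<close>.\<close>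

lemma transition_cocycle:
  assumes c: "c \<in> charts_at A p" and d: "d \<in> charts_at A p" and e: "e \<in> charts_at A p"
  shows "frechet_derivative (snd e \<circ> chart_inv d) (at (snd d p))
      (frechet_derivative (snd d \<circ> chart_inv c) (at (snd c p)) y)
    = frechet_derivative (snd e \<circ> chart_inv c) (at (snd c p)) y"
proof -
  have A: "c \<in> A" "d \<in> A" "p \<in> fst c" "p \<in> fst d"
    using c d by (auto simp: charts_at_def)
  have "(snd d \<circ> chart_inv c) (snd c p) = snd d p"
    using A by (simp add: chart_inv_chart)
  then have "((\<lambda>z. (snd e \<circ> chart_inv d) ((snd d \<circ> chart_inv c) z)) has_derivative
      (\<lambda>y. frechet_derivative (snd e \<circ> chart_inv d) (at (snd d p))
        (frechet_derivative (snd d \<circ> chart_inv c) (at (snd c p)) y))) (at (snd c p))"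
    using has_derivative_compose[OF transition_has_derivative[OF c d]]
      transition_has_derivative[OF d e] by metis
  then have "(snd e \<circ> chart_inv c has_derivative
      (\<lambda>y. frechet_derivative (snd e \<circ> chart_inv d) (at (snd d p))
        (frechet_derivative (snd d \<circ> chart_inv c) (at (snd c p)) y))) (at (snd c p))"
    by (rule has_derivative_transform_within_open[OF _ transition_differentiable(2)[OF c d]])
      (use A in \<open>auto simp: chart_inv_chart\<close>)
  then show ?thesis
    by (metis frechet_derivative_at)
qed

lemma transition_self:
  assumes "c \<in> charts_at A p"
  shows "frechet_derivative (snd c \<circ> chart_inv c) (at (snd c p)) y = y"
proof -
  have "(snd c \<circ> chart_inv c has_derivative (\<lambda>y. y)) (at (snd c p))"
    by (rule has_derivative_transform_within_open[OF has_derivative_ident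
          transition_differentiable(2)[OF assms assms]])
      (use assms in \<open>auto simp: charts_at_def chart_inv_chart\<close>)
  then show ?thesis
    by (metis frechet_derivative_at)
qed

lemma tangent_of_components_scale:
  assumes "c \<in> charts_at A p"
  shows "tangent_of_components A c p (l *\<^sub>R y) = (\<lambda>d. l *\<^sub>R tangent_of_components A c p y d)"
  using linear_cmul[OF linear_frechet_derivative[OF transition_differentiable(1)[OF assms]]]
  by (auto simp: tangent_of_components_def fun_eq_iff)

lemma tangent_of_components_self:
  assumes "c \<in> charts_at A p"
  shows "tangent_of_components A c p y c = y"
  using assms by (simp add: tangent_of_components_def transition_self)

lemma tangent_of_components_in_tangent_space:
  assumes "c \<in> charts_at A p"
  shows "tangent_of_components A c p y \<in> tangent_space A p"
  using assms by (simp add: tangent_of_components_def tangent_space_def transition_cocycle)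

lemma finsler_energy_in_chart:
  assumes F: "finsler_metric A F" and c: "c \<in> A"
  shows "finsler_energy (snd c ` fst c) (energy_in_chart A F c)"
proof
  show "open (snd c ` fst c)"
    by (rule open_chart_image[OF c])
  show "smooth_on (snd c ` fst c \<times> - {0}) (\<lambda>(x, y). energy_in_chart A F c x y)"
    using F c unfolding finsler_metric_def by blast
  fix x y assume x: "x \<in> snd c ` fst c"
  then obtain p where p: "p \<in> fst c" "x = snd c p"
    by blast
  then have cp: "c \<in> charts_at A p" and inv: "chart_inv c x = p"
    using c by (auto simp: charts_at_def chart_inv_chart)
  let ?v = "tangent_of_components A c p y"
  have E: "energy_in_chart A F c x y' = (F p (tangent_of_components A c p y'))\<^sup>2" for y'
    by (simp add: energy_in_chart_def inv)
  have v: "?v \<in> tangent_space A p"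
    by (rule tangent_of_components_in_tangent_space[OF cp])
  have pos: "?v \<noteq> (\<lambda>_. 0) \<Longrightarrow> F p ?v > 0" and hom: "\<And>l. F p (\<lambda>c. l *\<^sub>R ?v c) = \<bar>l\<bar> * F p ?v"
    using F c p(1) v unfolding finsler_metric_def by blast+
  show "energy_in_chart A F c x y > 0" if "y \<noteq> 0"
    using pos that tangent_of_components_self[OF cp, of y] by (fastforce simp: E)
  show "energy_in_chart A F c x (l *\<^sub>R y) = l\<^sup>2 * energy_in_chart A F c x y" for l
    by (simp add: E tangent_of_components_scale[OF cp] hom power_mult_distrib)
  show "\<xi> \<bullet> (fiber_hessian (energy_in_chart A F c) x y *v \<xi>) > 0" if "y \<noteq> 0" "\<xi> \<noteq> 0" for \<xi>
    using F c x that unfolding finsler_metric_def by blast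
qed

end

section \<open>Product charts\<close>

locale manifold_pair = M1: manifold X1 A1 + M2: manifold X2 A2
  for X1 :: "'a topology" and A1 :: "('a, 'm::finite) chart set"
    and X2 :: "'b topology" and A2 :: "('b, 'n::finite) chart set"
begin

lemma product_chart_inv:
  assumes "c1 \<in> A1" "c2 \<in> A2" "left_coords z \<in> snd c1 ` fst c1" "right_coords z \<in> snd c2 ` fst c2"
  shows "chart_inv (product_chart c1 c2) z = (chart_inv c1 (left_coords z), chart_inv c2 (right_coords z))"
proof -
  from assms(3,4) obtain p q where pq: "p \<in> fst c1" "q \<in> fst c2"
      "left_coords z = snd c1 p" "right_coords z = snd c2 q"
    by blast
  have inj: "inj_on (\<lambda>(p, q). join_coords (snd c1 p) (snd c2 q)) (fst c1 \<times> fst c2)"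
    using M1.chart_inj[OF assms(1)] M2.chart_inj[OF assms(2)]
    unfolding inj_on_def by (auto simp: join_coords_inject)
  have "(\<lambda>(p, q). join_coords (snd c1 p) (snd c2 q)) (p, q) = z"
    using pq(3,4)[symmetric] by simp
  then have "chart_inv (product_chart c1 c2) z = (p, q)"
    unfolding chart_inv_def product_chart_def fst_conv snd_conv
    using pq by (intro inv_into_f_eq[OF inj]) auto
  then show ?thesis
    using pq assms by (simp add: M1.chart_inv_chart M2.chart_inv_chart)
qed

lemma charts_at_product:
  "c \<in> charts_at (product_atlas A1 A2) (p, q) \<longleftrightarrow>
    (\<exists>c1\<in>charts_at A1 p. \<exists>c2\<in>charts_at A2 q. c = product_chart c1 c2)"
proof
  assume "c \<in> charts_at (product_atlas A1 A2) (p, q)"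
  then obtain c1 c2 where c: "c1 \<in> A1" "c2 \<in> A2" "c = product_chart c1 c2" and "(p, q) \<in> fst c"
    unfolding charts_at_def product_atlas_def by blast
  then have "p \<in> fst c1" "q \<in> fst c2"
    by (auto simp: product_chart_def)
  with c show "\<exists>c1\<in>charts_at A1 p. \<exists>c2\<in>charts_at A2 q. c = product_chart c1 c2"
    unfolding charts_at_def by blast
next
  assume "\<exists>c1\<in>charts_at A1 p. \<exists>c2\<in>charts_at A2 q. c = product_chart c1 c2"
  then obtain c1 c2 where c: "c1 \<in> charts_at A1 p" "c2 \<in> charts_at A2 q" "c = product_chart c1 c2"
    by blast
  moreover have "(p, q) \<in> fst c"
    using c by (auto simp: charts_at_def product_chart_def)
  ultimately show "c \<in> charts_at (product_atlas A1 A2) (p, q)"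
    unfolding charts_at_def product_atlas_def by blast
qed

lemma product_chart_apply [simp]:
  "left_coords (snd (product_chart c1 c2) (p, q)) = snd c1 p"
  "right_coords (snd (product_chart c1 c2) (p, q)) = snd c2 q"
  by (simp_all add: product_chart_def)

context
  fixes p :: 'a and q :: 'b and c1 c2
  assumes c1: "c1 \<in> charts_at A1 p" and c2: "c2 \<in> charts_at A2 q"
begin

lemma product_chart_neighbourhood:
  "open {z. left_coords z \<in> snd c1 ` fst c1 \<and> right_coords z \<in> snd c2 ` fst c2}"
  "snd (product_chart c1 c2) (p, q) \<in> {z. left_coords z \<in> snd c1 ` fst c1 \<and> right_coords z \<in> snd c2 ` fst c2}"
proof -
  have "{z. left_coords z \<in> snd c1 ` fst c1 \<and> right_coords z \<in> snd c2 ` fst c2}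
      = left_coords -` (snd c1 ` fst c1) \<inter> right_coords -` (snd c2 ` fst c2)"
    by blast
  moreover have "open (left_coords -` (snd c1 ` fst c1) \<inter> right_coords -` (snd c2 ` fst c2))"
    using c1 c2 unfolding charts_at_def
    by (intro open_Int open_vimage coords_linear[THEN linear_continuous_on]
        M1.open_chart_image M2.open_chart_image) simp_all
  ultimately show "open {z. left_coords z \<in> snd c1 ` fst c1 \<and> right_coords z \<in> snd c2 ` fst c2}"
    by simp
qed (use c1 c2 in \<open>simp add: charts_at_def\<close>)

text \<open>A map which only depends on one factor has, in a product chart, a derivative which only depends
  on the coordinates of that factor.\<close>

lemma has_derivative_fst_chart:
  assumes "(g \<circ> chart_inv c1 has_derivative D) (at (snd c1 p))"
  shows "(g \<circ> fst \<circ> chart_inv (product_chart c1 c2) has_derivative (\<lambda>v. D (left_coords v)))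
    (at (snd (product_chart c1 c2) (p, q)))"
proof (rule has_derivative_transform_within_open[OF _ product_chart_neighbourhood])
  show "((\<lambda>z. (g \<circ> chart_inv c1) (left_coords z)) has_derivative (\<lambda>v. D (left_coords v)))
      (at (snd (product_chart c1 c2) (p, q)))"
    by (rule has_derivative_compose[OF bounded_linear_imp_has_derivative[OF coords_linear(1)]])
      (simp only: product_chart_apply assms)
qed (use c1 c2 in \<open>simp add: charts_at_def product_chart_inv\<close>)

lemma has_derivative_snd_chart:
  assumes "(g \<circ> chart_inv c2 has_derivative D) (at (snd c2 q))"
  shows "(g \<circ> snd \<circ> chart_inv (product_chart c1 c2) has_derivative (\<lambda>v. D (right_coords v)))
    (at (snd (product_chart c1 c2) (p, q)))"
proof (rule has_derivative_transform_within_open[OF _ product_chart_neighbourhood])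
  show "((\<lambda>z. (g \<circ> chart_inv c2) (right_coords z)) has_derivative (\<lambda>v. D (right_coords v)))
      (at (snd (product_chart c1 c2) (p, q)))"
    by (rule has_derivative_compose[OF bounded_linear_imp_has_derivative[OF coords_linear(2)]])
      (simp only: product_chart_apply assms)
qed (use c1 c2 in \<open>simp add: charts_at_def product_chart_inv\<close>)

lemma product_transition_derivative:
  assumes d1: "d1 \<in> charts_at A1 p" and d2: "d2 \<in> charts_at A2 q"
  shows "frechet_derivative (snd (product_chart d1 d2) \<circ> chart_inv (product_chart c1 c2))
      (at (snd (product_chart c1 c2) (p, q))) v
    = join_coords (frechet_derivative (snd d1 \<circ> chart_inv c1) (at (snd c1 p)) (left_coords v))
        (frechet_derivative (snd d2 \<circ> chart_inv c2) (at (snd c2 q)) (right_coords v))"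
proof -
  let ?inv = "chart_inv (product_chart c1 c2)" and ?z = "snd (product_chart c1 c2) (p, q)"
  let ?D1 = "frechet_derivative (snd d1 \<circ> chart_inv c1) (at (snd c1 p))"
  let ?D2 = "frechet_derivative (snd d2 \<circ> chart_inv c2) (at (snd c2 q))"
  have join: "bounded_linear (\<lambda>(x, x'). join_coords x x' :: real^('m + 'n))"
    by (intro linear_conv_bounded_linear[THEN iffD1] linearI)
      (auto simp: join_coords_def vec_eq_iff split: sum.split)
  have "((\<lambda>z. ((snd d1 \<circ> fst \<circ> ?inv) z, (snd d2 \<circ> snd \<circ> ?inv) z)) has_derivative
      (\<lambda>v. (?D1 (left_coords v), ?D2 (right_coords v)))) (at ?z)"
    by (intro has_derivative_Pair has_derivative_fst_chart has_derivative_snd_chart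
        M1.transition_has_derivative M2.transition_has_derivative c1 c2 d1 d2)
  from bounded_linear.has_derivative[OF join this]
  have "(snd (product_chart d1 d2) \<circ> ?inv has_derivative
      (\<lambda>v. join_coords (?D1 (left_coords v)) (?D2 (right_coords v)))) (at ?z)"
    by (simp add: product_chart_def o_def case_prod_beta')
  from frechet_derivative_at[OF this, symmetric] show ?thesis
    by simp
qed

text \<open>The chart in the definition of the differential of a projection is an arbitrary product chart
  around the point; the cocycle rule removes the dependence on it. The hypothesis on \<open>w\<close> is the
  transformation rule from the given chart, which covers both tangent vectors of the product and
  those given by their components.\<close>

lemma tangent_projections:
  assumes w: "\<And>c. c \<in> charts_at (product_atlas A1 A2) (p, q) \<Longrightarrow>
      w c = frechet_derivative (snd c \<circ> chart_inv (product_chart c1 c2))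
        (at (snd (product_chart c1 c2) (p, q))) y"
  shows "tangent_fst A1 A2 (p, q) w = tangent_of_components A1 c1 p (left_coords y)"
    and "tangent_snd A1 A2 (p, q) w = tangent_of_components A2 c2 q (right_coords y)"
proof -
  define c where "c = (SOME c. c \<in> charts_at (product_atlas A1 A2) (p, q))"
  have "\<exists>c. c \<in> charts_at (product_atlas A1 A2) (p, q)"
    using c1 c2 charts_at_product by blast
  then have c: "c \<in> charts_at (product_atlas A1 A2) (p, q)"
    unfolding c_def by (rule someI_ex)
  then obtain e1 e2 where e: "e1 \<in> charts_at A1 p" "e2 \<in> charts_at A2 q" "c = product_chart e1 e2"
    unfolding charts_at_product by blast
  note wc = w[OF c]
  have wc_coords: "left_coords (w c) = frechet_derivative (snd e1 \<circ> chart_inv c1) (at (snd c1 p)) (left_coords y)"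
    "right_coords (w c) = frechet_derivative (snd e2 \<circ> chart_inv c2) (at (snd c2 q)) (right_coords y)"
    unfolding wc unfolding e(3) product_transition_derivative[OF e(1,2)] coords_join by (rule refl)+
  have "frechet_derivative (snd d \<circ> fst \<circ> chart_inv c) (at (snd c (p, q))) (w c)
      = frechet_derivative (snd d \<circ> chart_inv c1) (at (snd c1 p)) (left_coords y)"
    if d: "d \<in> charts_at A1 p" for d
  proof -
    note D = manifold_pair.has_derivative_fst_chart[OF manifold_pair_axioms e(1,2)
        M1.transition_has_derivative[OF e(1) d]]
    have "frechet_derivative (snd d \<circ> fst \<circ> chart_inv c) (at (snd c (p, q)))
        = (\<lambda>v. frechet_derivative (snd d \<circ> chart_inv e1) (at (snd e1 p)) (left_coords v))"
      unfolding e(3) by (rule frechet_derivative_at[OF D, symmetric])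
    then show ?thesis
      by (simp only: wc_coords M1.transition_cocycle[OF c1 e(1) d])
  qed
  then show "tangent_fst A1 A2 (p, q) w = tangent_of_components A1 c1 p (left_coords y)"
    unfolding tangent_fst_def tangent_map_def tangent_of_components_def c_def[symmetric] Let_def
    by (intro ext) simp
  have "frechet_derivative (snd d \<circ> snd \<circ> chart_inv c) (at (snd c (p, q))) (w c)
      = frechet_derivative (snd d \<circ> chart_inv c2) (at (snd c2 q)) (right_coords y)"
    if d: "d \<in> charts_at A2 q" for d
  proof -
    note D = manifold_pair.has_derivative_snd_chart[OF manifold_pair_axioms e(1,2)
        M2.transition_has_derivative[OF e(2) d]]
    have "frechet_derivative (snd d \<circ> snd \<circ> chart_inv c) (at (snd c (p, q)))
        = (\<lambda>v. frechet_derivative (snd d \<circ> chart_inv e2) (at (snd e2 q)) (right_coords v))"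
      unfolding e(3) by (rule frechet_derivative_at[OF D, symmetric])
    then show ?thesis
      by (simp only: wc_coords M2.transition_cocycle[OF c2 e(2) d])
  qed
  then show "tangent_snd A1 A2 (p, q) w = tangent_of_components A2 c2 q (right_coords y)"
    unfolding tangent_snd_def tangent_map_def tangent_of_components_def c_def[symmetric] Let_def
    by (intro ext) simp
qed

end

lemma minkowskian_product_energy_in_chart:
  assumes f: "product_function f" and c: "c1 \<in> A1" "c2 \<in> A2"
    and x: "left_coords x \<in> snd c1 ` fst c1" "right_coords x \<in> snd c2 ` fst c2"
  shows "energy_in_chart (product_atlas A1 A2) (minkowskian_product f A1 F1 A2 F2) (product_chart c1 c2) x y
    = f (energy_in_chart A1 F1 c1 (left_coords x) (left_coords y))
        (energy_in_chart A2 F2 c2 (right_coords x) (right_coords y))"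
proof -
  obtain p q where pq: "p \<in> fst c1" "q \<in> fst c2" "left_coords x = snd c1 p" "right_coords x = snd c2 q"
    using x by blast
  then have at: "c1 \<in> charts_at A1 p" "c2 \<in> charts_at A2 q"
    using c by (auto simp: charts_at_def)
  have x_eq: "x = snd (product_chart c1 c2) (p, q)"
    using pq(3,4)[symmetric] by (simp add: product_chart_def)
  have inv: "chart_inv (product_chart c1 c2) x = (p, q)" "chart_inv c1 (left_coords x) = p"
      "chart_inv c2 (right_coords x) = q"
    using pq c by (simp_all add: product_chart_inv[OF c x] M1.chart_inv_chart M2.chart_inv_chart)
  let ?w = "tangent_of_components (product_atlas A1 A2) (product_chart c1 c2) (p, q) y"
  have "tangent_fst A1 A2 (p, q) ?w = tangent_of_components A1 c1 p (left_coords y)"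
    "tangent_snd A1 A2 (p, q) ?w = tangent_of_components A2 c2 q (right_coords y)"
    by (intro tangent_projections[OF at]; simp add: tangent_of_components_def)+
  moreover have "f (a\<^sup>2) (b\<^sup>2) \<ge> 0" for a b
    using f unfolding product_function_def by simp
  ultimately show ?thesis
    by (simp add: energy_in_chart_def minkowskian_product_def inv)
qed

end

section \<open>The Cartan connection of a Minkowskian product\<close>

theorem proposition3p3:
  fixes X1 :: "'a topology" and A1 :: "('a, 'm::finite) chart set"
    and F1 :: "'a \<Rightarrow> ('a, 'm) tangent_vec \<Rightarrow> real"
    and X2 :: "'b topology" and A2 :: "('b, 'n::finite) chart set"
    and F2 :: "'b \<Rightarrow> ('b, 'n) tangent_vec \<Rightarrow> real"
    and f :: "real \<Rightarrow> real \<Rightarrow> real"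
    and F :: "'a \<times> 'b \<Rightarrow> ('a \<times> 'b, 'm + 'n) tangent_vec \<Rightarrow> real"
    and c1 :: "('a, 'm) chart" and c2 :: "('b, 'n) chart"
    and p :: 'a and q :: 'b
    and w :: "('a \<times> 'b, 'm + 'n) tangent_vec"
    and A :: "('a \<times> 'b, 'm + 'n) chart set" and c :: "('a \<times> 'b, 'm + 'n) chart"
    and x y :: "real^('m + 'n)"
  assumes "finsler_manifold X1 A1 F1" and "finsler_manifold X2 A2 F2"
    and "product_function f"
    and F: "F = minkowskian_product f A1 F1 A2 F2"
    and A: "A = product_atlas A1 A2"
    and "c1 \<in> charts_at A1 p" and "c2 \<in> charts_at A2 q"
    and c: "c = product_chart c1 c2"
    and "w \<in> tangent_space A (p, q)"
    and "tangent_fst A1 A2 (p, q) w \<noteq> (\<lambda>_. 0)"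
    and "tangent_snd A1 A2 (p, q) w \<noteq> (\<lambda>_. 0)"
    and x: "x = snd c (p, q)" and y: "y = w c"
  shows "(\<forall>i j. cartan_coeff (energy_in_chart A F c) (Inl i) (Inl j) x y =
            cartan_coeff (energy_in_chart A1 F1 c1) i j (left_coords x) (left_coords y)) \<and>
         (\<forall>i' j'. cartan_coeff (energy_in_chart A F c) (Inr i') (Inr j') x y =
            cartan_coeff (energy_in_chart A2 F2 c2) i' j' (right_coords x) (right_coords y)) \<and>
         (\<forall>i' j. cartan_coeff (energy_in_chart A F c) (Inr i') (Inl j) x y = 0) \<and>
         (\<forall>i j'. cartan_coeff (energy_in_chart A F c) (Inl i) (Inr j') x y = 0)"
proof -
  interpret manifold_pair X1 A1 X2 A2
    using assms(1,2) by unfold_locales (simp_all add: finsler_manifold_def)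
  have at: "c1 \<in> A1" "p \<in> fst c1" "c2 \<in> A2" "q \<in> fst c2"
    using assms(6,7) by (auto simp: charts_at_def)
  interpret E: minkowskian_product_energy "snd c1 ` fst c1" "energy_in_chart A1 F1 c1"
    "snd c2 ` fst c2" "energy_in_chart A2 F2 c2" f "energy_in_chart A F c"
  proof (intro minkowskian_product_energy.intro minkowskian_product_energy_axioms.intro)
    show "finsler_energy (snd c1 ` fst c1) (energy_in_chart A1 F1 c1)"
      "finsler_energy (snd c2 ` fst c2) (energy_in_chart A2 F2 c2)"
      using assms(1,2) at M1.finsler_energy_in_chart M2.finsler_energy_in_chart
      by (auto simp: finsler_manifold_def)
  qed (use assms(3) at in \<open>simp_all add: A F c minkowskian_product_energy_in_chart\<close>)
  have "c \<in> charts_at A (p, q)"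
    using assms(6,7) by (auto simp: A c charts_at_product)
  then have w: "w d = frechet_derivative (snd d \<circ> chart_inv c) (at (snd c (p, q))) y"
    if "d \<in> charts_at A (p, q)" for d
    using assms(9) that unfolding tangent_space_def y by blast
  have "tangent_fst A1 A2 (p, q) w = tangent_of_components A1 c1 p (left_coords y)"
    "tangent_snd A1 A2 (p, q) w = tangent_of_components A2 c2 q (right_coords y)"
    by (rule tangent_projections[OF assms(6,7) w[unfolded A c]], assumption)+
  then have "left_coords y \<noteq> 0" "right_coords y \<noteq> 0"
    using assms(10,11) M1.tangent_of_components_scale[OF assms(6), of 0 0]
      M2.tangent_of_components_scale[OF assms(7), of 0 0] by auto
  then have "y \<in> E.fiber"
    by (simp add: E.fiber_def)
  moreover have "x \<in> E.base"
    using at by (simp add: E.base_def x c)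
  ultimately show ?thesis
    by (simp add: E.cartan_coeff_of_product)
qed

end
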